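(* Let $0 \le \alpha < 1$, let $f = h + \overline{g} \in \mathcal{F}(\alpha)$ with $h(z) = z + \sum_{k=2}^\infty a_k z^k$, $g(z) = \sum_{k=1}^\infty b_k z^k$, and let $n, m \ge 2$ be integers. For $r \in (0,1)$ define $$\psi(n,m,r,\alpha) = A(r,\alpha) - \sum_{k=n+1}^\infty k A_k(\alpha) r^{k-1} - \sum_{k=m+1}^\infty \frac{k(k-1)}{k-2\alpha} A_k(\alpha) r^{k-1},$$ where $A(r,\alpha) = \frac{1-r^2}{r^2} L(r,\alpha)^2$ and $A_k(\alpha) = \frac{1}{k!}\prod_{j=2}^k (j-2\alpha)$. Let $r_{n,m}$ be the smallest zero of $r \mapsto \psi(n,m,r,\alpha)$ in $(0,1)$. Then for every $\theta \in \mathbb{R}$ the harmonic polynomial $$s_{n,m}(f;\theta)(z) = \sum_{k=1}^n a_k z^k + e^{i\theta}\,\overline{\sum_{k=1}^m b_k z^k} \qquad (a_1 = 1)$$ is univalent in the disk $|z| < r_{n,m}$. Moreover, when $\alpha = 1/2$, $r_{n,m} \ge 1 - \frac{2\log l}{l}$, where $l = \min\{n,m\} \ge 3$.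
   Context: $\mathbb{D} = \{z \in \mathbb{C} : |z| < 1\}$. For $\alpha \ge -1/2$, $\mathcal{F}(\alpha)$ denotes the set of complex-valued harmonic functions $f = h + \overline{g}$ on $\mathbb{D}$, with $h, g$ analytic in $\mathbb{D}$ normalized by $h(0) = g(0) = 0$, $h'(0) = 1$, such that $\operatorname{Re}\left(1 + \frac{z h''(z)}{h'(z)}\right) > \alpha$ for all $z \in \mathbb{D}$ and, for some real constant $\theta$, $g'(z) = e^{i\theta} z h'(z)$ for all $z \in \mathbb{D}$. Here $L(r,\alpha)$ equals $\frac{2r}{1+r} - \log(1+r)$ if $\alpha=0$, $2\log(1+r) - r$ if $\alpha = 1/2$, and $\frac{(1+r)^{2\alpha}(1+r+2\alpha-2r\alpha) - (1+r)(1+2\alpha)}{2\alpha(1+r)(2\alpha-1)}$ if $\alpha \in (0,1)\setminus\{1/2\}$; equivalently $L(r,\alpha)=\int_0^r (1-\rho)(1+\rho)^{-2(1-\alpha)}d\rho$. (The function $\psi(n,m,\cdot,\alpha)$ is positive near $0$ and tends to $-\infty$ as $r \to 1^-$, so $r_{n,m}$ exists.) *)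

theory Defs
  imports "HOL-Analysis.Analysis"
begin

text \<open>The class F(alpha), described by the pair (h, g) with f = h + conj g.\<close>
definition class_F :: "real \<Rightarrow> (complex \<Rightarrow> complex) \<Rightarrow> (complex \<Rightarrow> complex) \<Rightarrow> bool" where
  "class_F \<alpha> h g \<longleftrightarrow>
     h holomorphic_on ball 0 1 \<and> g holomorphic_on ball 0 1 \<and>
     h 0 = 0 \<and> g 0 = 0 \<and> deriv h 0 = 1 \<and>
     (\<forall>z\<in>ball 0 1. deriv h z \<noteq> 0 \<and>
        Re (1 + z * deriv (deriv h) z / deriv h z) > \<alpha>) \<and>
     (\<exists>\<theta>::real. \<forall>z\<in>ball 0 1. deriv g z = exp (\<i> * of_real \<theta>) * z * deriv h z)"

definition taylor_coeff :: "(complex \<Rightarrow> complex) \<Rightarrow> nat \<Rightarrow> complex" where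
  "taylor_coeff F k = (deriv ^^ k) F 0 / of_nat (fact k)"

definition L_fun :: "real \<Rightarrow> real \<Rightarrow> real" where
  "L_fun r \<alpha> = integral {0..r} (\<lambda>\<rho>. (1 - \<rho>) * (1 + \<rho>) powr (- 2 * (1 - \<alpha>)))"

definition A_fun :: "real \<Rightarrow> real \<Rightarrow> real" where
  "A_fun r \<alpha> = (1 - r\<^sup>2) / r\<^sup>2 * (L_fun r \<alpha>)\<^sup>2"

definition A_coef :: "nat \<Rightarrow> real \<Rightarrow> real" where
  "A_coef k \<alpha> = (\<Prod>j=2..k. (real j - 2 * \<alpha>)) / fact k"

definition psi :: "nat \<Rightarrow> nat \<Rightarrow> real \<Rightarrow> real \<Rightarrow> real" where
  "psi n m r \<alpha> = A_fun r \<alpha>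
     - (\<Sum>i. (let k = i + n + 1 in real k * A_coef k \<alpha> * r ^ (k - 1)))
     - (\<Sum>i. (let k = i + m + 1 in
              real k * (real k - 1) / (real k - 2 * \<alpha>) * A_coef k \<alpha> * r ^ (k - 1)))"

definition r_nm :: "nat \<Rightarrow> nat \<Rightarrow> real \<Rightarrow> real" where
  "r_nm n m \<alpha> = (LEAST r. r \<in> {0<..<1} \<and> psi n m r \<alpha> = 0)"

definition s_nm :: "nat \<Rightarrow> nat \<Rightarrow> (complex \<Rightarrow> complex) \<Rightarrow> (complex \<Rightarrow> complex) \<Rightarrow> real \<Rightarrow> complex \<Rightarrow> complex" where
  "s_nm n m h g \<theta> z = (\<Sum>k=1..n. taylor_coeff h k * z ^ k)
     + exp (\<i> * of_real \<theta>) * cnj (\<Sum>k=1..m. taylor_coeff g k * z ^ k)"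

end

theory Submission
  imports Defs "HOL-Complex_Analysis.Complex_Analysis"
begin

text \<open>For \<open>\<alpha> \<ge> 0\<close> the function \<open>h\<close> maps every disk \<open>|z| \<le> r < 1\<close> injectively onto a convex set
  (Study), so the segment between two image points lifts to the disk. Along such lifts
  \<open>|h z1 - h z2| \<ge> (1 + r) powr (- 2 (1 - \<alpha>)) |z1 - z2|\<close> by the distortion theorem, and passing from
  \<open>h\<close> to the close-to-convex function \<open>h + \<epsilon> g\<close>, \<open>|\<epsilon>| = 1\<close>, costs at most a factor \<open>1 - r\<close>.
  Hence \<open>h + e\<^bsup>i\<theta>\<^esup> cnj g\<close> expands distances at least by \<open>L'(r) = (1 - r) (1 + r) powr (- 2 (1 - \<alpha>))\<close>,
  and \<open>L'(r) \<ge> A(r, \<alpha>)\<close> because \<open>L(r) \<le> r (1 + r) powr (\<alpha> - 3/2)\<close>. The sharp coefficient bounds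
  \<open>|a\<^sub>k| \<le> A\<^sub>k\<close> and \<open>|b\<^sub>k| \<le> (k - 1) / (k - 2\<alpha>) A\<^sub>k\<close> show that the discarded tails of the
  power series are Lipschitz with the two sums in \<open>\<psi>\<close> as constants, so positivity of \<open>\<psi>\<close> on \<open>(0, r\<^sub>n\<^sub>m)\<close> gives injectivity.\<close>

section \<open>Convexity of images of disks\<close>

text \<open>The curvature condition is local: a segment is kept inside a disk by looking at its
  lift, but the lift presupposes that \<open>h\<close> is injective and that the segment already
  lies in the image. Convexity and injectivity are therefore continued together in the radius, up to
  1. The exponent \<open>\<alpha> - 3/2\<close> is dictated by the definition of A: with it,
  \<open>(1 - r^2) / r^2\<close> times the square of the bound on L is exactly L'(r). Finally,
  \<open>r_nm\<close> is a \<open>LEAST\<close> over the reals, so it has the expected properties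
  only once a smallest zero is known to be attained; hence the sign analysis of \<open>psi\<close>
  at both ends of the interval.\<close>

locale convex_function =
  fixes h :: "complex \<Rightarrow> complex"
  assumes holo: "h holomorphic_on ball 0 1"
    and deriv_nz: "z \<in> ball 0 1 \<Longrightarrow> deriv h z \<noteq> 0"
    and curvature_pos: "z \<in> ball 0 1 \<Longrightarrow> Re (1 + z * deriv (deriv h) z / deriv h z) > 0"
begin

lemma has_deriv: "z \<in> ball 0 1 \<Longrightarrow> (h has_field_derivative deriv h z) (at z)"
  using holo holomorphic_derivI open_ball by blast

lemma deriv_holo: "deriv h holomorphic_on ball 0 1"
  using holo holomorphic_deriv open_ball by blast

lemma has_deriv2: "z \<in> ball 0 1 \<Longrightarrow> (deriv h has_field_derivative deriv (deriv h) z) (at z)"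
  using deriv_holo holomorphic_derivI open_ball by blast

lemma inverse_branch:
  assumes "\<rho> \<le> 1" "inj_on h (ball 0 \<rho>)"
  obtains k where "open (h ` ball 0 \<rho>)" "\<And>z. z \<in> ball 0 \<rho> \<Longrightarrow> k (h z) = z"
    "\<And>z. z \<in> ball 0 \<rho> \<Longrightarrow> (k has_field_derivative 1 / deriv h z) (at (h z))"
proof -
  have hol: "h holomorphic_on ball 0 \<rho>"
    using holo assms(1) by (rule holomorphic_on_subset[OF _ subset_ball])
  obtain k where k: "k holomorphic_on (h ` ball 0 \<rho>)"
      "\<And>z. z \<in> ball 0 \<rho> \<Longrightarrow> deriv h z * deriv k (h z) = 1"
      "\<And>z. z \<in> ball 0 \<rho> \<Longrightarrow> k (h z) = z"
    using holomorphic_has_inverse[OF hol open_ball assms(2)] by metis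
  have op: "open (h ` ball 0 \<rho>)"
    using open_mapping_thm3[OF hol open_ball assms(2)] .
  show thesis
  proof (rule that[OF op k(3)])
    fix z :: complex assume z: "z \<in> ball 0 \<rho>"
    have "(k has_field_derivative deriv k (h z)) (at (h z))"
      using holomorphic_derivI[OF k(1) op] z by blast
    moreover have "deriv k (h z) = 1 / deriv h z"
      using k(2)[OF z] by (metis mult_zero_left nonzero_eq_divide_eq mult.commute zero_neq_one)
    ultimately show "(k has_field_derivative 1 / deriv h z) (at (h z))" by simp
  qed
qed

text \<open>Where the lift of a segment is tangent to a circle about the origin, its squared modulus has
  second derivative \<open>2 |V|\<^sup>2 Re (1 + z h'' / h') > 0\<close>, with \<open>V\<close> the velocity of the lift; hence
  the modulus has no interior maximum.\<close>
lemma norm_lift_segment_le: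
  assumes \<rho>: "\<rho> \<le> 1" and inj: "inj_on h (ball 0 \<rho>)"
    and z1: "z1 \<in> ball 0 \<rho>" and z2: "z2 \<in> ball 0 \<rho>"
    and seg: "closed_segment (h z1) (h z2) \<subseteq> h ` ball 0 \<rho>"
    and w: "w \<in> ball 0 \<rho>" "h w \<in> closed_segment (h z1) (h z2)"
  shows "norm w \<le> max (norm z1) (norm z2)"
proof (rule ccontr)
  assume "\<not> ?thesis"
  then have wgt: "norm w > norm z1" "norm w > norm z2" by auto
  obtain k where op: "open (h ` ball 0 \<rho>)" and k: "\<And>z. z \<in> ball 0 \<rho> \<Longrightarrow> k (h z) = z"
    and dk: "\<And>z. z \<in> ball 0 \<rho> \<Longrightarrow> (k has_field_derivative 1 / deriv h z) (at (h z))"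
    by (fact inverse_branch[OF \<rho> inj])
  define \<Delta> where "\<Delta> = h z2 - h z1"
  define p where "p t = h z1 + of_real t * \<Delta>" for t :: real
  define \<gamma> where "\<gamma> t = k (p t)" for t
  define V where "V t = \<Delta> / deriv h (\<gamma> t)" for t
  have pseg: "p t \<in> closed_segment (h z1) (h z2)" if "t \<in> {0..1}" for t
    using that by (auto simp: p_def \<Delta>_def in_segment scaleR_conv_of_real algebra_simps intro!: exI[of _ t])
  have \<gamma>: "\<gamma> t \<in> ball 0 \<rho>" "h (\<gamma> t) = p t" if "t \<in> {0..1}" for t
    using pseg[OF that] seg k unfolding \<gamma>_def by force+
  have \<gamma>1: "\<gamma> t \<in> ball 0 1" if "t \<in> {0..1}" for t
    using \<gamma>(1)[OF that] \<rho> by auto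
  have g0: "\<gamma> 0 = z1" and g1: "\<gamma> 1 = z2"
    using k[OF z1] k[OF z2] by (simp_all add: \<gamma>_def p_def \<Delta>_def)
  obtain tw where tw: "tw \<in> {0..1}" "\<gamma> tw = w"
  proof -
    obtain u where "0 \<le> u" "u \<le> 1" "h w = (1 - u) *\<^sub>R h z1 + u *\<^sub>R h z2"
      using w(2) by (auto simp: in_segment)
    moreover from this have "h w = p u"
      by (simp add: p_def \<Delta>_def scaleR_conv_of_real algebra_simps)
    ultimately show thesis
      using that[of u] k[OF w(1)] by (simp add: \<gamma>_def)
  qed
  have \<Delta>0: "\<Delta> \<noteq> 0"
  proof
    assume "\<Delta> = 0"
    then have "\<gamma> tw = \<gamma> 0" by (simp add: \<gamma>_def p_def)
    then show False using g0 tw(2) wgt by simp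
  qed
  have d\<gamma>: "(\<gamma> has_vector_derivative V t) (at t)" if t: "t \<in> {0..1}" for t
  proof -
    have "(p has_vector_derivative \<Delta>) (at t)"
      unfolding p_def by (auto intro!: derivative_eq_intros simp: has_vector_derivative_def scaleR_conv_of_real)
    then have "(k \<circ> p has_vector_derivative \<Delta> * (1 / deriv h (\<gamma> t))) (at t)"
      using dk[OF \<gamma>(1)[OF t]] \<gamma>(2)[OF t] by (intro field_vector_diff_chain_at) auto
    then show ?thesis by (simp add: \<gamma>_def[abs_def] o_def V_def)
  qed
  \<comment> \<open>The squared modulus is written as a product so that the product rule applies;
    its derivative is twice the real part of \<open>u\<close>.\<close>
  define \<phi> where "\<phi> t = Re (cnj (\<gamma> t) * \<gamma> t)" for t
  define u where "u t = cnj (\<gamma> t) * V t" for t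
  have \<phi>_norm: "\<phi> t = (norm (\<gamma> t))\<^sup>2" for t
    by (simp add: \<phi>_def cmod_def power2_eq_square)
  have d\<phi>: "(\<phi> has_real_derivative 2 * Re (u t)) (at t)" if t: "t \<in> {0..1}" for t
  proof -
    have "((\<lambda>t. cnj (\<gamma> t) * \<gamma> t) has_vector_derivative cnj (\<gamma> t) * V t + cnj (V t) * \<gamma> t) (at t)"
      by (intro has_vector_derivative_mult has_vector_derivative_cnj d\<gamma> t)
    then have "(\<phi> has_vector_derivative Re (cnj (\<gamma> t) * V t + cnj (V t) * \<gamma> t)) (at t)"
      unfolding \<phi>_def[abs_def] by (rule bounded_linear.has_vector_derivative[OF bounded_linear_Re])
    moreover have "Re (cnj (\<gamma> t) * V t + cnj (V t) * \<gamma> t) = 2 * Re (u t)"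
      by (simp add: u_def)
    ultimately show ?thesis by (simp add: has_real_derivative_iff_has_vector_derivative)
  qed
  have cont: "continuous_on {0..1} \<phi>"
    using d\<phi> by (meson DERIV_isCont continuous_at_imp_continuous_on)
  obtain t0 where t0: "t0 \<in> {0..1}" "\<And>t. t \<in> {0..1} \<Longrightarrow> \<phi> t \<le> \<phi> t0"
    using continuous_attains_sup[OF _ _ cont] by auto
  have big: "norm (\<gamma> t0) \<ge> norm w"
    using t0(2)[OF tw(1)] tw(2) by (simp add: \<phi>_norm)
  have t0': "0 < t0" "t0 < 1"
    using t0(1) big wgt g0 g1 by (auto simp: less_le)
  have \<gamma>0: "\<gamma> t0 \<noteq> 0" using big wgt(1) by (metis norm_le_zero_iff norm_not_less_zero order.strict_trans1 norm_zero not_le)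
  have Reu: "Re (u t0) = 0"
  proof -
    have "2 * Re (u t0) = 0"
    proof (rule DERIV_local_max[OF d\<phi>[OF t0(1)]])
      show "0 < min t0 (1 - t0)" using t0' by simp
      show "\<forall>y. \<bar>t0 - y\<bar> < min t0 (1 - t0) \<longrightarrow> \<phi> y \<le> \<phi> t0"
        using t0(2) by (auto simp: abs_less_iff)
    qed
    then show ?thesis by simp
  qed
  define c where "c = deriv (deriv h) (\<gamma> t0) / deriv h (\<gamma> t0)"
  have hnz: "deriv h (\<gamma> t0) \<noteq> 0" using deriv_nz \<gamma>1[OF t0(1)] by blast
  have dV: "(V has_vector_derivative - c * (V t0)\<^sup>2) (at t0)"
  proof -
    have "((\<lambda>z. \<Delta> / deriv h z) has_field_derivative - \<Delta> * c / deriv h (\<gamma> t0)) (at (\<gamma> t0))"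
      using has_deriv2[OF \<gamma>1[OF t0(1)]] hnz
      by (auto intro!: derivative_eq_intros simp: c_def power2_eq_square)
    from field_vector_diff_chain_at[OF d\<gamma>[OF t0(1)] this]
    show ?thesis by (simp add: o_def V_def[abs_def] power2_eq_square mult_ac)
  qed
  define q where "q = (norm (V t0))\<^sup>2"
  have qpos: "q > 0" using \<Delta>0 hnz by (simp add: q_def V_def)
  have du: "(u has_vector_derivative of_real q * (1 + \<gamma> t0 * c)) (at t0)"
  proof -
    have 1: "cnj (V t0) * V t0 = of_real q"
      unfolding q_def by (metis complex_norm_square mult.commute)
    \<comment> \<open>At the maximum the lift is tangent to a circle, so \<open>u t0\<close> is
      purely imaginary. Conjugating it trades \<open>cnj (\<gamma> t0) * V t0\<close> for
      \<open>\<gamma> t0 * cnj (V t0)\<close>, which is what makes the curvature expression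
      \<open>1 + \<gamma> t0 * c\<close> appear.\<close>
    have "u t0 = - cnj (u t0)" using Reu by (simp add: complex_eq_iff)
    then have 2: "cnj (\<gamma> t0) * V t0 = - (\<gamma> t0 * cnj (V t0))" by (simp add: u_def)
    have "cnj (\<gamma> t0) * (- c * (V t0)\<^sup>2) = - c * V t0 * (cnj (\<gamma> t0) * V t0)"
      by (simp add: power2_eq_square mult_ac)
    also have "\<dots> = c * \<gamma> t0 * (cnj (V t0) * V t0)" unfolding 2 by (simp add: mult_ac)
    finally have 3: "cnj (\<gamma> t0) * (- c * (V t0)\<^sup>2) + cnj (V t0) * V t0 = of_real q * (1 + \<gamma> t0 * c)"
      unfolding 1 by (simp add: algebra_simps)
    have "(u has_vector_derivative cnj (\<gamma> t0) * (- c * (V t0)\<^sup>2) + cnj (V t0) * V t0) (at t0)"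
      unfolding u_def[abs_def]
      by (intro has_vector_derivative_mult has_vector_derivative_cnj d\<gamma> dV t0)
    then show ?thesis unfolding 3 .
  qed
  have "((\<lambda>t. Re (u t)) has_real_derivative q * Re (1 + \<gamma> t0 * c)) (at t0)"
    using bounded_linear.has_vector_derivative[OF bounded_linear_Re du]
    by (simp add: has_real_derivative_iff_has_vector_derivative)
  moreover have "q * Re (1 + \<gamma> t0 * c) > 0"
    using curvature_pos[OF \<gamma>1[OF t0(1)]] qpos by (simp add: c_def)
  \<comment> \<open>Differentiating \<open>Re (u t)\<close> at the single point \<open>t0\<close>
    suffices: it becomes positive just to the right of \<open>t0\<close>, so \<open>\<phi>\<close>
    increases there beyond its maximum.\<close>
  ultimately obtain d where d: "d > 0" "\<And>e. 0 < e \<Longrightarrow> e < d \<Longrightarrow> Re (u t0) < Re (u (t0 + e))"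
    using DERIV_pos_inc_right by metis
  define e where "e = min (d / 2) (1 - t0)"
  have e: "e > 0" "e < d" "t0 + e \<le> 1" using d(1) t0' by (auto simp: e_def)
  have "\<phi> t0 < \<phi> (t0 + e)"
  proof (rule DERIV_pos_imp_increasing_open[of t0 "t0 + e" \<phi>])
    show "t0 < t0 + e" using e by simp
    show "\<exists>y. (\<phi> has_real_derivative y) (at x) \<and> 0 < y" if "t0 < x" "x < t0 + e" for x
      using d\<phi>[of x] d(2)[of "x - t0"] that e t0' Reu by (intro exI[of _ "2 * Re (u x)"]) auto
    show "continuous_on {t0..t0 + e} \<phi>"
      using cont by (rule continuous_on_subset) (use e t0' in auto)
  qed
  then show False using t0(2)[of "t0 + e"] e t0' by auto
qed

text \<open>The invariant of the continuation in the radius. Injectivity is included because lifting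
  a segment needs an inverse branch.\<close>

definition convex_up_to :: "real \<Rightarrow> bool" where
  "convex_up_to r \<longleftrightarrow> inj_on h (ball 0 r) \<and> convex (h ` ball 0 r)"

text \<open>The inverse has derivative at most \<open>1 / m\<close> on a convex set, hence is
  Lipschitz there. This is the quantitative form of injectivity that survives a small perturbation
  of the radius.\<close>

lemma convex_up_to_expansion:
  assumes r: "r \<le> 1" "convex_up_to r" and m: "m > 0" "\<And>z. z \<in> ball 0 r \<Longrightarrow> m \<le> norm (deriv h z)"
    and z: "z \<in> ball 0 r" "w \<in> ball 0 r"
  shows "m * norm (z - w) \<le> norm (h z - h w)"
proof -
  have inj: "inj_on h (ball 0 r)" and conv: "convex (h ` ball 0 r)"
    using r by (auto simp: convex_up_to_def)
  obtain k where "open (h ` ball 0 r)" and k: "\<And>z. z \<in> ball 0 r \<Longrightarrow> k (h z) = z"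
    and dk: "\<And>z. z \<in> ball 0 r \<Longrightarrow> (k has_field_derivative 1 / deriv h z) (at (h z))"
    by (fact inverse_branch[OF r(1) inj])
  have "norm (k (h z) - k (h w)) \<le> (1 / m) * norm (h z - h w)"
  proof (rule field_differentiable_bound[OF conv])
    fix y assume "y \<in> h ` ball 0 r"
    then obtain v where v: "v \<in> ball 0 r" "y = h v" by blast
    show "(k has_field_derivative 1 / deriv h (k y)) (at y within h ` ball 0 r)"
      using dk[OF v(1)] k[OF v(1)] v(2) by (simp add: has_field_derivative_at_within)
    show "norm (1 / deriv h (k y)) \<le> 1 / m"
      using m(2)[OF v(1)] m(1) k[OF v(1)] v(2) by (simp add: norm_divide frac_le)
  qed (use z in auto)
  then show ?thesis using m(1) k z by (simp add: field_simps)
qed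

text \<open>The continuation starts from local injectivity: on a tiny disk all image points lie in a
  ball around \<open>h 0\<close> that the image of a larger injectivity disk contains, so every
  segment between them can be lifted.\<close>

lemma convex_up_to_small: "\<exists>r>0. r < 1 \<and> convex_up_to r"
proof -
  obtain \<rho> where \<rho>: "\<rho> > 0" "ball (0::complex) \<rho> \<subseteq> ball 0 1" "inj_on h (ball 0 \<rho>)"
    using has_complex_derivative_locally_injective[OF holo _ open_ball deriv_nz]
    by (metis centre_in_ball zero_less_one)
  have \<rho>1: "\<rho> \<le> 1" using \<rho>(1,2) by (simp add: ball_subset_ball_iff)
  have "open (h ` ball 0 \<rho>)" by (rule inverse_branch[OF \<rho>1 \<rho>(3)])
  then obtain e where e: "e > 0" "ball (h 0) e \<subseteq> h ` ball 0 \<rho>"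
    using \<rho>(1) by (metis centre_in_ball imageI openE)
  have "isCont h 0" using has_deriv[of 0] DERIV_isCont by auto
  then obtain d where d: "d > 0" "\<And>z. norm z < d \<Longrightarrow> dist (h 0) (h z) < e"
    using e(1) unfolding continuous_at_eps_delta by (metis dist_0_norm dist_commute)
  define r where "r = min d (\<rho> / 2)"
  have r: "r > 0" "r < \<rho>" using d \<rho> by (auto simp: r_def)
  have "convex (h ` ball 0 r)"
  proof (rule convex_contains_segment[THEN iffD2, rule_format])
    show "closed_segment x y \<subseteq> h ` ball 0 r" if xy: "x \<in> h ` ball 0 r" "y \<in> h ` ball 0 r" for x y
    proof
      fix v assume v: "v \<in> closed_segment x y"
      obtain z1 z2 where z: "x = h z1" "y = h z2" "norm z1 < r" "norm z2 < r" using xy by auto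
      have "x \<in> ball (h 0) e" "y \<in> ball (h 0) e" using z d(2) by (auto simp: r_def)
      then have seg: "closed_segment x y \<subseteq> h ` ball 0 \<rho>"
        using e(2) by (meson closed_segment_subset convex_ball order_trans)
      then obtain w where w: "w \<in> ball 0 \<rho>" "v = h w" using v by auto
      have "norm w \<le> max (norm z1) (norm z2)"
        using norm_lift_segment_le[OF \<rho>1 \<rho>(3), of z1 z2 w] z r w v seg by auto
      then show "v \<in> h ` ball 0 r" using w z by auto
    qed
  qed
  moreover have "inj_on h (ball 0 r)" using \<rho>(3) by (rule inj_on_subset) (use r in auto)
  ultimately show ?thesis unfolding convex_up_to_def using r \<rho>1 by (intro exI[of _ r]) auto
qed

lemma norm_deriv_bounded_below:
  assumes "r < 1"
  obtains m where "m > 0" "\<And>z. z \<in> cball 0 r \<Longrightarrow> m \<le> norm (deriv h z)"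
proof (cases "r < 0")
  case True
  then show thesis using that[of 1] by simp
next
  case False
  have sub: "cball 0 r \<subseteq> ball (0::complex) 1" using assms by auto
  then have "continuous_on (cball 0 r) (\<lambda>z. norm (deriv h z))"
    using deriv_holo by (intro continuous_on_norm) (meson holomorphic_on_imp_continuous_on holomorphic_on_subset)
  then obtain z0 where z0: "z0 \<in> cball 0 r" "\<And>z. z \<in> cball 0 r \<Longrightarrow> norm (deriv h z0) \<le> norm (deriv h z)"
    using continuous_attains_inf[of "cball (0::complex) r" "\<lambda>z. norm (deriv h z)"] False by auto
  then show thesis using that[of "norm (deriv h z0)"] deriv_nz sub by auto
qed

text \<open>Comparing \<open>h\<close> with the rescaled function \<open>z \<mapsto> h (s z) / s\<close>, \<open>s = r / r'\<close>, carries the expansion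
  property to a slightly larger disk; there every segment between image points stays close to a segment
  of the smaller convex image and so can be lifted.\<close>
lemma convex_up_to_extend:
  assumes r: "0 < r" "r < 1" "convex_up_to r"
  shows "\<exists>r'>r. r' < 1 \<and> convex_up_to r'"
proof -
  define r1 where "r1 = (1 + r) / 2"
  have r1: "r < r1" "r1 < 1" using r by (auto simp: r1_def)
  have sub1: "cball (0::complex) r1 \<subseteq> ball 0 1" using r1 by auto
  obtain m where m: "m > 0" "\<And>z. z \<in> cball 0 r \<Longrightarrow> m \<le> norm (deriv h z)"
    using norm_deriv_bounded_below[OF r(2)] by blast
  have ucd: "uniformly_continuous_on (cball 0 r1) (deriv h)"
    using sub1 deriv_holo
    by (intro compact_uniformly_continuous) (auto intro: holomorphic_on_imp_continuous_on holomorphic_on_subset)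
  have uch: "uniformly_continuous_on (cball 0 r1) h"
    using sub1 holo
    by (intro compact_uniformly_continuous) (auto intro: holomorphic_on_imp_continuous_on holomorphic_on_subset)
  have scale: "of_real (r / r') * z \<in> ball 0 r" "dist (of_real (r / r') * z) z \<le> r' - r"
    if "r < r'" "z \<in> ball 0 r'" for r' and z :: complex
  proof -
    have r': "0 < r'" using that r by simp
    have "norm (of_real (r / r') * z) = r / r' * norm z" using r r' by (simp add: norm_mult norm_divide)
    also have "\<dots> < r / r' * r'" using that r r' by (intro mult_strict_left_mono) auto
    finally show "of_real (r / r') * z \<in> ball 0 r" using r' by simp
    have "of_real (r / r') * z - z = of_real (r / r' - 1) * z" by (simp add: algebra_simps)
    then have "dist (of_real (r / r') * z) z = \<bar>r / r' - 1\<bar> * norm z"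
      unfolding dist_norm by (metis norm_mult norm_of_real)
    also have "\<dots> \<le> (1 - r / r') * r'" using that r r'
      by (intro mult_mono) (auto simp: abs_if field_simps)
    also have "\<dots> = r' - r" using r' by (simp add: field_simps)
    finally show "dist (of_real (r / r') * z) z \<le> r' - r" .
  qed
  obtain d where d: "d > 0" "\<And>z w. z \<in> cball 0 r1 \<Longrightarrow> w \<in> cball 0 r1 \<Longrightarrow> dist w z < d
      \<Longrightarrow> dist (deriv h w) (deriv h z) < m / 2"
    using ucd m(1) unfolding uniformly_continuous_on_def by (metis half_gt_zero)
  \<comment> \<open>Within \<open>d\<close> of each other, points have values of \<open>h'\<close>
    that differ by less than \<open>m / 2\<close>, half the expansion constant on the smaller
    disk.\<close>
  define r2 where "r2 = min r1 (r + d / 2)"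
  have r2: "r < r2" "r2 < 1" "r2 \<le> r1" "r2 - r < d" using d(1) r1 by (auto simp: r2_def)
  define s where "s = r / r2"
  have s: "0 < s" "s < 1" using r r2 by (auto simp: s_def)
  have inj2: "inj_on h (ball 0 r2)"
  proof (rule inj_onI)
    fix z w assume zw: "z \<in> ball 0 r2" "w \<in> ball 0 r2" "h z = h w"
    \<comment> \<open>The rescaled function expands distances by at least \<open>m\<close>, whereas
      \<open>E\<close>, its difference from \<open>h\<close>, is Lipschitz with constant
      \<open>m / 2\<close>. If \<open>h z = h w\<close>, the two estimates are compatible only for
      \<open>z = w\<close>.\<close>
    define E where "E z = h z - h (of_real s * z) / of_real s" for z
    have "norm (E z - E w) \<le> (m / 2) * norm (z - w)"
    proof (rule field_differentiable_bound[where S = "ball 0 r2" and f' = "\<lambda>z. deriv h z - deriv h (of_real s * z)"])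
      fix x assume x: "x \<in> ball (0::complex) r2"
      have sx: "of_real s * x \<in> ball 0 r" "dist (of_real s * x) x \<le> r2 - r"
        using scale[OF r2(1) x] by (auto simp: s_def)
      have d1: "(h has_field_derivative deriv h x) (at x)" using has_deriv x r2 by auto
      have "((\<lambda>x. of_real s * x) has_field_derivative of_real s) (at x)"
        by (auto intro!: derivative_eq_intros)
      moreover have "(h has_field_derivative deriv h (of_real s * x)) (at (of_real s * x))"
        using has_deriv sx r by auto
      ultimately have d2: "((\<lambda>x. h (of_real s * x)) has_field_derivative deriv h (of_real s * x) * of_real s) (at x)"
        by (rule DERIV_chain2[rotated])
      have "((\<lambda>x. h x - h (of_real s * x) / of_real s) has_field_derivative
          deriv h x - deriv h (of_real s * x) * of_real s / of_real s) (at x)"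
        by (intro DERIV_diff DERIV_cdivide d1 d2)
      then show "(E has_field_derivative deriv h x - deriv h (of_real s * x)) (at x within ball 0 r2)"
        using s by (simp add: E_def[abs_def] has_field_derivative_at_within)
      show "norm (deriv h x - deriv h (of_real s * x)) \<le> m / 2"
        using d(2)[of "of_real s * x" x] x sx r1 r2 by (simp add: dist_norm norm_minus_commute)
    qed (use zw in auto)
    moreover have "E z - E w = - (h (of_real s * z) - h (of_real s * w)) / of_real s"
      using zw(3) by (simp add: E_def field_simps diff_divide_distrib)
    ultimately have 1: "norm (h (of_real s * z) - h (of_real s * w)) \<le> s * (m / 2 * norm (z - w))"
      using s by (simp add: norm_divide field_simps norm_minus_commute)
    have "m * norm (of_real s * z - of_real s * w) \<le> norm (h (of_real s * z) - h (of_real s * w))"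
      using convex_up_to_expansion[OF _ r(3) m(1)] m(2) r scale[OF r2(1)] zw by (simp add: s_def)
    moreover have "norm (of_real s * z - of_real s * w) = s * norm (z - w)"
      using s by (metis norm_mult norm_of_real abs_of_pos right_diff_distrib)
    ultimately have "m * (s * norm (z - w)) \<le> s * (m / 2 * norm (z - w))" using 1 by (metis order_trans)
    then have "s * m * norm (z - w) \<le> 0" by (simp add: algebra_simps)
    then show "z = w" using s m(1) by (simp add: mult_le_0_iff)
  qed
  have op: "open (h ` ball 0 r2)" using inverse_branch[OF _ inj2] r2 by auto
  have cpt: "compact (h ` cball 0 r)"
    using sub1 holo r1
    by (intro compact_continuous_image) (auto intro!: holomorphic_on_imp_continuous_on elim!: holomorphic_on_subset)
  \<comment> \<open>Compactness gives a margin \<open>e\<close>: a segment may leave the smaller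
    convex image by less than \<open>e\<close> and still be liftable through the injective branch on
    \<open>ball 0 r2\<close>.\<close>
  obtain e where e: "e > 0" "(\<Union>x\<in>h ` cball 0 r. ball x e) \<subseteq> h ` ball 0 r2"
  proof -
    have "h ` cball 0 r \<subseteq> h ` ball 0 r2" using r2 by (intro image_mono) auto
    then show thesis using that compact_subset_open_imp_ball_epsilon_subset[OF cpt op] by blast
  qed
  obtain d2 where d2: "d2 > 0" "\<And>z w. z \<in> cball 0 r1 \<Longrightarrow> w \<in> cball 0 r1 \<Longrightarrow> dist w z < d2
      \<Longrightarrow> dist (h w) (h z) < e"
    using uch e(1) unfolding uniformly_continuous_on_def by metis
  \<comment> \<open>Shrinking a point of \<open>ball 0 r'\<close> into \<open>ball 0 r\<close> moves
    it by less than \<open>d2\<close>, hence its image by less than \<open>e\<close>. Injectivity is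
    available up to \<open>r2\<close>; convexity is claimed only up to \<open>r'\<close>.\<close>
  define r' where "r' = min r2 (r + d2 / 2)"
  have r': "r < r'" "r' < 1" "r' \<le> r2" "r' - r < d2" using d2(1) r2 by (auto simp: r'_def)
  have "convex (h ` ball 0 r')"
  proof (rule convex_contains_segment[THEN iffD2, rule_format])
    fix x y v assume xy: "x \<in> h ` ball 0 r'" "y \<in> h ` ball 0 r'"
    show "closed_segment x y \<subseteq> h ` ball 0 r'"
    proof
      obtain z1 z2 where z: "x = h z1" "y = h z2" "z1 \<in> ball 0 r'" "z2 \<in> ball 0 r'" using xy by auto
      define t where "t = complex_of_real (r / r')"
      have t: "t * z1 \<in> ball 0 r" "t * z2 \<in> ball 0 r"
        using scale(1)[OF r'(1)] z by (auto simp: t_def)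
      have close: "dist (h (t * z1)) x < e" "dist (h (t * z2)) y < e"
        using d2(2)[of z1 "t * z1"] d2(2)[of z2 "t * z2"] scale(2)[OF r'(1) z(3)] scale(2)[OF r'(1) z(4)]
          z t r1 r2 r' by (auto simp: t_def)
      have seg: "closed_segment x y \<subseteq> h ` ball 0 r2"
      proof
        fix v assume "v \<in> closed_segment x y"
        then obtain u where u: "0 \<le> u" "u \<le> 1" "v = (1 - u) *\<^sub>R x + u *\<^sub>R y" by (auto simp: in_segment)
        define v' where "v' = (1 - u) *\<^sub>R h (t * z1) + u *\<^sub>R h (t * z2)"
        have "v' \<in> h ` ball 0 r"
          using r(3) t u unfolding convex_up_to_def v'_def by (auto intro!: convexD)
        then have v': "v' \<in> h ` cball 0 r" by auto
        have "v' - v = (1 - u) *\<^sub>R (h (t * z1) - x) + u *\<^sub>R (h (t * z2) - y)"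
          by (simp add: v'_def u(3) algebra_simps)
        also have "norm \<dots> \<le> (1 - u) * norm (h (t * z1) - x) + u * norm (h (t * z2) - y)"
          using u by (intro norm_triangle_le) simp
        also have "\<dots> < e"
          using u close by (intro convex_bound_lt) (auto simp: dist_norm)
        finally have "v \<in> ball v' e" by (simp add: dist_norm)
        then show "v \<in> h ` ball 0 r2" using v' e(2) by blast
      qed
      fix v assume v: "v \<in> closed_segment x y"
      then obtain w where w: "w \<in> ball 0 r2" "v = h w" using seg by auto
      have "norm w \<le> max (norm z1) (norm z2)"
        using norm_lift_segment_le[OF _ inj2, of z1 z2 w] z r2 r' w v seg by auto
      then show "v \<in> h ` ball 0 r'" using w z by auto
    qed
  qed
  moreover have "inj_on h (ball 0 r')" using inj2 by (rule inj_on_subset) (use r' in auto)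
  ultimately show ?thesis using r' unfolding convex_up_to_def by blast
qed

text \<open>Any two points of the disk of radius \<open>Sup T\<close> lie in a common disk of good
  radius, so both properties pass to the supremum; the extension step then excludes a supremum below
  1.\<close>

theorem convex_up_to_1: "convex_up_to 1"
proof -
  define T where "T = {r. 0 < r \<and> r \<le> 1 \<and> convex_up_to r}"
  have ne: "T \<noteq> {}" using convex_up_to_small by (auto simp: T_def intro: less_imp_le)
  have bdd: "bdd_above T" by (auto simp: T_def bdd_above_def)
  define R where "R = Sup T"
  have R: "0 < R" "R \<le> 1"
  proof -
    obtain t where t: "t \<in> T" using ne by auto
    then have "t \<le> R" unfolding R_def using bdd by (rule cSup_upper)
    then show "0 < R" using t by (auto simp: T_def)
    show "R \<le> 1" unfolding R_def using ne by (rule cSup_least) (auto simp: T_def)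
  qed
  have ex: "\<exists>t\<in>T. z \<in> ball 0 t \<and> w \<in> ball 0 t \<and> t \<le> R" if "z \<in> ball 0 R" "w \<in> ball 0 R" for z w :: complex
  proof -
    have "max (norm z) (norm w) < Sup T" using that by (simp add: R_def)
    then obtain t where "t \<in> T" "max (norm z) (norm w) < t" using less_cSup_iff[OF ne bdd] by auto
    moreover from this have "t \<le> R" unfolding R_def by (intro cSup_upper bdd)
    ultimately show ?thesis by auto
  qed
  have "inj_on h (ball 0 R)"
  proof (rule inj_onI)
    fix z w assume zw: "z \<in> ball 0 R" "w \<in> ball 0 R" "h z = h w"
    with ex obtain t where "t \<in> T" "z \<in> ball 0 t" "w \<in> ball 0 t" by blast
    then show "z = w" using zw(3) by (auto simp: T_def convex_up_to_def dest: inj_onD)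
  qed
  moreover have "convex (h ` ball 0 R)"
  proof (rule convex_contains_segment[THEN iffD2, rule_format])
    fix x y assume "x \<in> h ` ball 0 R" "y \<in> h ` ball 0 R"
    then obtain z w where zw: "z \<in> ball 0 R" "w \<in> ball 0 R" "x = h z" "y = h w" by auto
    with ex obtain t where t: "t \<in> T" "z \<in> ball 0 t" "w \<in> ball 0 t" "t \<le> R" by blast
    then have "closed_segment x y \<subseteq> h ` ball 0 t"
      using zw by (intro closed_segment_subset) (auto simp: T_def convex_up_to_def)
    also have "\<dots> \<subseteq> h ` ball 0 R" using t by (intro image_mono) auto
    finally show "closed_segment x y \<subseteq> h ` ball 0 R" .
  qed
  ultimately have cR: "convex_up_to R" by (simp add: convex_up_to_def)
  have "R = 1"
  proof (rule ccontr)
    assume "R \<noteq> 1"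
    then obtain r' where r': "r' > R" "r' < 1" "convex_up_to r'"
      using convex_up_to_extend[of R] R cR by auto
    then have "r' \<in> T" using R by (simp add: T_def)
    then have "r' \<le> R" unfolding R_def by (intro cSup_upper bdd)
    then show False using r' by simp
  qed
  then show ?thesis using cR by simp
qed

section \<open>Expansion estimates along lifted segments\<close>

lemma segment_lift:
  assumes "norm z1 \<le> r" "norm z2 \<le> r" "r < 1"
  obtains k where "k (h z1) = z1" "k (h z2) = z2"
    "\<And>y. y \<in> closed_segment (h z1) (h z2) \<Longrightarrow> norm (k y) \<le> r \<and> h (k y) = y"
    "\<And>y. y \<in> closed_segment (h z1) (h z2) \<Longrightarrow> (k has_field_derivative 1 / deriv h (k y)) (at y)"
proof -
  have inj: "inj_on h (ball 0 1)" and conv: "convex (h ` ball 0 1)"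
    using convex_up_to_1 by (auto simp: convex_up_to_def)
  obtain k where "open (h ` ball 0 1)" and k: "\<And>z. z \<in> ball 0 1 \<Longrightarrow> k (h z) = z"
    and dk: "\<And>z. z \<in> ball 0 1 \<Longrightarrow> (k has_field_derivative 1 / deriv h z) (at (h z))"
    by (fact inverse_branch[OF order_refl inj])
  have z: "z1 \<in> ball 0 1" "z2 \<in> ball 0 1" using assms by auto
  then have seg: "closed_segment (h z1) (h z2) \<subseteq> h ` ball 0 1"
    using conv by (intro closed_segment_subset) auto
  have *: "norm (k y) \<le> r \<and> h (k y) = y \<and> (k has_field_derivative 1 / deriv h (k y)) (at y)"
    if y: "y \<in> closed_segment (h z1) (h z2)" for y
  proof -
    obtain w where w: "w \<in> ball 0 1" "y = h w" using y seg by auto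
    have "norm w \<le> max (norm z1) (norm z2)"
      using norm_lift_segment_le[OF order_refl inj z seg w(1)] w(2) y by auto
    then show ?thesis using assms w k dk by auto
  qed
  show thesis using that[of k] k z * by auto
qed

text \<open>Only the segment between the two image points matters, and its lift stays in the closed
  disk of radius \<open>r\<close>. A lower bound for \<open>|h'|\<close> on that disk alone is
  therefore enough, although the inverse branch is taken on the whole unit disk.\<close>

lemma expansion_le:
  assumes z: "norm z1 \<le> r" "norm z2 \<le> r" "r < 1"
    and m: "m > 0" "\<And>z. norm z \<le> r \<Longrightarrow> m \<le> norm (deriv h z)"
  shows "m * norm (z1 - z2) \<le> norm (h z1 - h z2)"
proof -
  obtain k where k: "k (h z1) = z1" "k (h z2) = z2"
    "\<And>y. y \<in> closed_segment (h z1) (h z2) \<Longrightarrow> norm (k y) \<le> r \<and> h (k y) = y"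
    "\<And>y. y \<in> closed_segment (h z1) (h z2) \<Longrightarrow> (k has_field_derivative 1 / deriv h (k y)) (at y)"
    by (fact segment_lift[OF z])
  have "norm (k (h z1) - k (h z2)) \<le> (1 / m) * norm (h z1 - h z2)"
  proof (rule field_differentiable_bound[OF convex_closed_segment])
    fix y assume y: "y \<in> closed_segment (h z1) (h z2)"
    show "(k has_field_derivative 1 / deriv h (k y)) (at y within closed_segment (h z1) (h z2))"
      using k(4)[OF y] by (rule has_field_derivative_at_within)
    have "m \<le> norm (deriv h (k y))" using k(3)[OF y] m(2) by blast
    then show "norm (1 / deriv h (k y)) \<le> 1 / m" using m(1) by (simp add: norm_divide frac_le)
  qed auto
  then show ?thesis using m(1) k by (simp add: field_simps)
qed

text \<open>The Noshiro-Warschawski argument in the image plane of \<open>h\<close>: as a function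
  of \<open>h\<close>, \<open>F\<close> has derivative \<open>q\<close>, so the real part of its
  difference quotient over a segment is a value of \<open>Re q\<close> by the mean value
  theorem.\<close>

lemma close_to_convex_expansion:
  assumes z: "norm z1 \<le> r" "norm z2 \<le> r" "r < 1"
    and F: "\<And>z. norm z \<le> r \<Longrightarrow> (F has_field_derivative deriv h z * q z) (at z)"
    and q: "\<And>z. norm z \<le> r \<Longrightarrow> b \<le> Re (q z)"
  shows "b * norm (h z1 - h z2) \<le> norm (F z1 - F z2)"
proof (cases "h z1 = h z2")
  case False
  obtain k where k: "k (h z1) = z1" "k (h z2) = z2"
    "\<And>y. y \<in> closed_segment (h z1) (h z2) \<Longrightarrow> norm (k y) \<le> r \<and> h (k y) = y"
    "\<And>y. y \<in> closed_segment (h z1) (h z2) \<Longrightarrow> (k has_field_derivative 1 / deriv h (k y)) (at y)"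
    by (fact segment_lift[OF z])
  define \<Delta> where "\<Delta> = h z2 - h z1"
  have \<Delta>: "\<Delta> \<noteq> 0" using False by (simp add: \<Delta>_def)
  define p where "p t = h z1 + of_real t * \<Delta>" for t :: real
  \<comment> \<open>Dividing by \<open>\<Delta>\<close> removes the direction of the segment,
    leaving \<open>Re q\<close> as the derivative.\<close>
  define G where "G t = Re (F (k (p t)) / \<Delta>)" for t
  have "(G has_real_derivative Re (q (k (p t)))) (at t)" if t: "0 \<le> t" "t \<le> 1" for t
  proof -
    have pt: "p t \<in> closed_segment (h z1) (h z2)"
      using t by (auto simp: p_def \<Delta>_def in_segment scaleR_conv_of_real algebra_simps intro!: exI[of _ t])
    note kt = k(3)[OF pt]
    have nz: "deriv h (k (p t)) \<noteq> 0" using kt z(3) by (intro deriv_nz) auto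
    have dp: "(p has_vector_derivative \<Delta>) (at t)"
      unfolding p_def by (auto intro!: derivative_eq_intros simp: has_vector_derivative_def scaleR_conv_of_real)
    have "((\<lambda>y. F (k y)) has_field_derivative (deriv h (k (p t)) * q (k (p t))) * (1 / deriv h (k (p t)))) (at (p t))"
      using kt by (intro DERIV_chain2[OF F k(4)[OF pt]]) auto
    then have "((\<lambda>y. F (k y) / \<Delta>) has_field_derivative q (k (p t)) / \<Delta>) (at (p t))"
      using nz by (intro DERIV_cdivide) (simp add: field_simps)
    from field_vector_diff_chain_at[OF dp this]
    have "((\<lambda>t. F (k (p t)) / \<Delta>) has_vector_derivative q (k (p t))) (at t)"
      using \<Delta> by (simp add: o_def)
    from bounded_linear.has_vector_derivative[OF bounded_linear_Re this]
    show ?thesis by (simp add: G_def[abs_def] has_real_derivative_iff_has_vector_derivative)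
  qed
  then obtain t where t: "0 < t" "t < 1" "G 1 - G 0 = Re (q (k (p t)))"
    using MVT2[of 0 1 G "\<lambda>t. Re (q (k (p t)))"] by auto
  have "p t \<in> closed_segment (h z1) (h z2)"
    using t by (auto simp: p_def \<Delta>_def in_segment scaleR_conv_of_real algebra_simps intro!: exI[of _ t])
  then have "b \<le> G 1 - G 0" unfolding t(3) using k(3) q by blast
  also have "\<dots> = Re ((F z2 - F z1) / \<Delta>)"
    using k by (simp add: G_def p_def \<Delta>_def diff_divide_distrib)
  also have "\<dots> \<le> norm (F z2 - F z1) / norm \<Delta>" by (metis complex_Re_le_cmod norm_divide)
  finally show ?thesis using \<Delta> by (simp add: \<Delta>_def field_simps norm_minus_commute)
qed auto

end

section \<open>Distortion and coefficient bounds\<close>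

text \<open>The Cayley transform carries the right half-plane to the unit disk and 1 to 0, so the
  Schwarz lemma applies; the bound is the Schwarz estimate solved for
  \<open>Re (q z)\<close>.\<close>

lemma Re_ge_of_Re_pos:
  assumes hol: "q holomorphic_on ball 0 1" and q0: "q 0 = 1"
    and pos: "\<And>z. z \<in> ball 0 1 \<Longrightarrow> Re (q z) > 0" and z: "norm z < 1"
  shows "Re (q z) \<ge> (1 - norm z) / (1 + norm z)"
proof -
  have nz: "q z + 1 \<noteq> 0" if "z \<in> ball 0 1" for z
    using pos[OF that] by (auto simp: complex_eq_iff)
  define w where "w z = (q z - 1) / (q z + 1)" for z
  have "w holomorphic_on ball 0 1"
    unfolding w_def using hol nz by (intro holomorphic_intros) auto
  moreover have "w 0 = 0" by (simp add: w_def q0)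
  moreover have "norm (w z) < 1" if "norm z < 1" for z
  proof -
    have "(norm (q z - 1))\<^sup>2 < (norm (q z + 1))\<^sup>2"
      using pos[of z] that unfolding cmod_power2 by (simp add: power2_eq_square algebra_simps)
    then have "norm (q z - 1) < norm (q z + 1)" by (rule power2_less_imp_less) simp
    then show ?thesis using nz[of z] that by (simp add: w_def norm_divide)
  qed
  ultimately have "norm (w z) \<le> norm z" using z by (rule Schwarz_Lemma(1))
  then have "norm (q z - 1) \<le> norm z * norm (q z + 1)"
    using nz[of z] z by (simp add: w_def norm_divide field_simps)
  then have "(norm (q z - 1))\<^sup>2 \<le> (norm z * norm (q z + 1))\<^sup>2" by (rule power_mono) simp
  then have "(Re (q z) - 1)\<^sup>2 + (Im (q z))\<^sup>2 \<le> (norm z)\<^sup>2 * ((Re (q z) + 1)\<^sup>2 + (Im (q z))\<^sup>2)"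
    by (simp add: cmod_power2 power_mult_distrib)
  moreover have "(norm z)\<^sup>2 * (Im (q z))\<^sup>2 \<le> 1 * (Im (q z))\<^sup>2"
    using z by (intro mult_right_mono) (auto simp: power_le_one)
  ultimately have "(Re (q z) - 1)\<^sup>2 \<le> (norm z * (Re (q z) + 1))\<^sup>2"
    unfolding power_mult_distrib by (smt (verit) distrib_left)
  then have "\<bar>Re (q z) - 1\<bar> \<le> \<bar>norm z * (Re (q z) + 1)\<bar>" by (simp only: abs_le_square_iff)
  then have "1 - Re (q z) \<le> norm z * (Re (q z) + 1)"
    using pos[of z] z by (simp add: abs_mult)
  then show ?thesis by (subst pos_divide_le_eq) (auto simp: algebra_simps add_pos_nonneg)
qed

text \<open>Cauchy's formula as an integral over a real interval, a form in which conjugates and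
  real parts can be taken under the integral sign.\<close>

lemma taylor_coeff_has_integral:
  assumes hol: "f holomorphic_on ball 0 1" and \<rho>: "0 < \<rho>" "\<rho> < 1"
  shows "((\<lambda>t. f (of_real \<rho> * exp (2 * of_real pi * \<i> * of_real t)) /
      (of_real \<rho> * exp (2 * of_real pi * \<i> * of_real t)) ^ k) has_integral taylor_coeff f k) {0..1}"
proof -
  define u where "u t = of_real \<rho> * exp (2 * of_real pi * \<i> * of_real t)" for t :: real
  have "f holomorphic_on cball 0 \<rho>" using hol by (rule holomorphic_on_subset) (use \<rho> in auto)
  then have "((\<lambda>u. f u / (u - 0) ^ Suc k) has_contour_integral
      (2 * pi * \<i>) / fact k * (deriv ^^ k) f 0) (circlepath 0 \<rho>)"
    using \<rho> by (intro Cauchy_has_contour_integral_higher_derivative_circlepath)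
      (auto intro: holomorphic_on_imp_continuous_on holomorphic_on_subset)
  then have "((\<lambda>t. f (u t) / u t ^ Suc k * (2 * pi * \<i> * u t)) has_integral
      (2 * pi * \<i>) / fact k * (deriv ^^ k) f 0) {0..1}"
  proof -
    have 1: "circlepath 0 \<rho> t = u t" for t by (simp add: circlepath u_def)
    have 2: "vector_derivative (circlepath 0 \<rho>) (at t) = 2 * pi * \<i> * u t" for t
      by (simp add: vector_derivative_circlepath u_def)
    assume "((\<lambda>u. f u / (u - 0) ^ Suc k) has_contour_integral
      (2 * pi * \<i>) / fact k * (deriv ^^ k) f 0) (circlepath 0 \<rho>)"
    then show ?thesis by (simp only: has_contour_integral 1 2 diff_zero)
  qed
  then have "((\<lambda>t. (1 / (2 * pi * \<i>)) * (f (u t) / u t ^ Suc k * (2 * pi * \<i> * u t))) has_integral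
      (1 / (2 * pi * \<i>)) * ((2 * pi * \<i>) / fact k * (deriv ^^ k) f 0)) {0..1}"
    by (rule has_integral_mult_right)
  moreover have "(1 / (2 * pi * \<i>)) * (f (u t) / u t ^ Suc k * (2 * pi * \<i> * u t)) = f (u t) / u t ^ k" for t
    using \<rho> by (simp add: u_def field_simps)
  moreover have "(1 / (2 * pi * \<i>)) * ((2 * pi * \<i>) / fact k * (deriv ^^ k) f 0) = taylor_coeff f k"
    by (simp add: taylor_coeff_def)
  ultimately show ?thesis by (simp add: u_def)
qed

text \<open>On \<open>|u| = \<rho>\<close> the integral of \<open>cnj (f u) / u ^ k\<close> is a multiple of the conjugate of that of
  \<open>f u * u ^ k\<close>, hence zero; so \<open>f\<close> may be replaced by the positive function \<open>2 Re f\<close> in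
  Cauchy's formula.\<close>
lemma norm_taylor_coeff_le_Re_pos:
  assumes hol: "f holomorphic_on ball 0 1" and pos: "\<And>z. z \<in> ball 0 1 \<Longrightarrow> Re (f z) > 0" and k: "k \<ge> 1"
  shows "norm (taylor_coeff f k) \<le> 2 * Re (f 0)"
proof -
  have main: "norm (taylor_coeff f k) * \<rho> ^ k \<le> 2 * Re (f 0)" if \<rho>: "0 < \<rho>" "\<rho> < 1" for \<rho>
  proof -
    define u where "u t = of_real \<rho> * exp (2 * of_real pi * \<i> * of_real t)" for t :: real
    have nu: "norm (u t) = \<rho>" for t using \<rho> by (simp add: u_def norm_mult)
    have u0: "u t \<noteq> 0" for t using \<rho> by (simp add: u_def)
    have I1: "((\<lambda>t. f (u t) / u t ^ k) has_integral taylor_coeff f k) {0..1}"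
      using taylor_coeff_has_integral[OF hol \<rho>] by (simp add: u_def)
    \<comment> \<open>The constant coefficient of this product vanishes because
      \<open>k \<ge> 1\<close>; it yields the vanishing conjugate integral.\<close>
    have "(\<lambda>z. f z * z ^ k) holomorphic_on ball 0 1" using hol by (intro holomorphic_intros)
    from taylor_coeff_has_integral[OF this \<rho>, of 0]
    have "((\<lambda>t. f (u t) * u t ^ k) has_integral 0) {0..1}"
      using k by (simp add: u_def taylor_coeff_def power_0_left)
    from has_integral_mult_right[OF has_integral_cnj[THEN iffD2, OF this], of "1 / of_real \<rho> ^ (2 * k)"]
    have "((\<lambda>t. 1 / of_real \<rho> ^ (2 * k) * cnj (f (u t) * u t ^ k)) has_integral 0) {0..1}"
      by (simp add: o_def)
    moreover have "1 / of_real \<rho> ^ (2 * k) * cnj (f (u t) * u t ^ k) = cnj (f (u t)) / u t ^ k" for t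
    proof -
      have "u t * cnj (u t) = of_real \<rho> ^ 2" using complex_norm_square[of "u t"] nu by simp
      then have "u t ^ k * cnj (u t) ^ k = of_real \<rho> ^ (2 * k)"
        by (metis power_mult power_mult_distrib)
      then show ?thesis using u0[of t] \<rho> by (simp add: field_simps)
    qed
    ultimately have I2: "((\<lambda>t. cnj (f (u t)) / u t ^ k) has_integral 0) {0..1}" by simp
    have I3: "((\<lambda>t. of_real (2 * Re (f (u t))) / u t ^ k) has_integral taylor_coeff f k) {0..1}"
      using has_integral_add[OF I1 I2] by (simp add: complex_add_cnj flip: add_divide_distrib)
    \<comment> \<open>The coefficient formula of order 0 is the mean value property; positivity
      turns it into an L1 bound for \<open>Re f\<close> on the circle.\<close>
    have I4: "((\<lambda>t. Re (f (u t))) has_integral Re (f 0)) {0..1}"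
      using has_integral_Re[OF taylor_coeff_has_integral[OF hol \<rho>, of 0]]
      by (simp add: u_def taylor_coeff_def)
    have I5: "((\<lambda>t. 2 * Re (f (u t)) / \<rho> ^ k) has_integral 2 * Re (f 0) / \<rho> ^ k) {0..1}"
      using has_integral_divide[OF has_integral_mult_right[OF I4, of 2], of "\<rho> ^ k"] by simp
    have "norm (integral {0..1} (\<lambda>t. of_real (2 * Re (f (u t))) / u t ^ k))
        \<le> integral {0..1} (\<lambda>t. 2 * Re (f (u t)) / \<rho> ^ k)"
    proof (rule integral_norm_bound_integral)
      show "norm (of_real (2 * Re (f (u t))) / u t ^ k) \<le> 2 * Re (f (u t)) / \<rho> ^ k" for t
        using pos[of "u t"] nu[of t] \<rho> by (simp add: norm_divide norm_power norm_mult)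
    qed (use I3 I5 in auto)
    then show ?thesis
      using integral_unique[OF I3] integral_unique[OF I5] \<rho> by (simp add: field_simps)
  qed
  \<comment> \<open>Letting the radius tend to 1 removes the factor
    \<open>\<rho> ^ k\<close>.\<close>
  have "((\<lambda>\<rho>. norm (taylor_coeff f k) * \<rho> ^ k) \<longlongrightarrow> norm (taylor_coeff f k) * 1 ^ k) (at_left 1)"
    by (intro tendsto_intros)
  moreover have "\<forall>\<^sub>F \<rho> in at_left (1::real). norm (taylor_coeff f k) * \<rho> ^ k \<le> 2 * Re (f 0)"
    using eventually_at_left_field[of _ "1::real"] main by (auto intro!: exI[of _ 0])
  ultimately have "norm (taylor_coeff f k) * 1 ^ k \<le> 2 * Re (f 0)"
    by (rule tendsto_upperbound) simp
  then show ?thesis by simp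
qed

section \<open>Taylor coefficients and the majorants \<open>A_coef\<close>\<close>

lemma taylor_coeff_Suc: "of_nat (Suc j) * taylor_coeff f (Suc j) = taylor_coeff (deriv f) j"
proof -
  have "(deriv ^^ Suc j) f 0 = (deriv ^^ j) (deriv f) 0"
    by (simp add: funpow_Suc_right del: funpow.simps)
  moreover have "of_nat (fact (Suc j)) = of_nat (Suc j) * (of_nat (fact j) :: complex)"
    by (simp only: fact_Suc of_nat_mult of_nat_id)
  ultimately show ?thesis
    unfolding taylor_coeff_def by (simp del: funpow.simps of_nat_Suc fact_Suc of_nat_fact)
qed

lemma has_fps_expansion_taylor:
  assumes "f holomorphic_on ball 0 1"
  shows "f has_fps_expansion Abs_fps (taylor_coeff f)"
proof -
  have "f has_fps_expansion fps_expansion f 0"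
    using assms by (intro has_fps_expansion_fps_expansion[of "ball 0 1"]) auto
  moreover have "fps_expansion f 0 = Abs_fps (taylor_coeff f)"
    by (simp add: fps_expansion_def taylor_coeff_def fps_eq_iff)
  ultimately show ?thesis by simp
qed

lemma fps_expansion_unique_eventually:
  fixes F G :: "complex fps"
  assumes "f has_fps_expansion F" "g has_fps_expansion G" "eventually (\<lambda>z. f z = g z) (nhds 0)"
  shows "F = G"
  using assms fps_expansion_unique_complex has_fps_expansion_cong[OF assms(3) refl] by blast

text \<open>The start at 1 matters: the product begins at 2, so \<open>A_coef\<close> is 1 at both 0
  and 1, and the recursion would fail at 0 for nonzero \<open>\<alpha>\<close>.\<close>

lemma A_coef_Suc: "k \<ge> 1 \<Longrightarrow> real (Suc k) * A_coef (Suc k) \<alpha> = (real (Suc k) - 2 * \<alpha>) * A_coef k \<alpha>"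
  unfolding A_coef_def by (simp add: prod.nat_ivl_Suc' field_simps del: of_nat_Suc)

lemma A_coef_1 [simp]: "A_coef (Suc 0) \<alpha> = 1"
  by (simp add: A_coef_def)

lemma A_coef_pos: assumes "\<alpha> < 1" shows "A_coef k \<alpha> > 0"
  unfolding A_coef_def using assms by (intro divide_pos_pos prod_pos) auto

text \<open>The recursion satisfied by the coefficients of \<open>(1 - z) powr (- 2 (1 - \<alpha>))\<close>.\<close>
lemma A_coef_recursion:
  "real j * (real (Suc j) * A_coef (Suc j) \<alpha>) = 2 * (1 - \<alpha>) * (\<Sum>i<j. real (Suc i) * A_coef (Suc i) \<alpha>)"
proof (induction j)
  case (Suc j)
  have "2 * (1 - \<alpha>) * (\<Sum>i<Suc j. real (Suc i) * A_coef (Suc i) \<alpha>)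
      = (real j + 2 * (1 - \<alpha>)) * (real (Suc j) * A_coef (Suc j) \<alpha>)"
    using Suc by (simp add: algebra_simps del: of_nat_Suc)
  also have "\<dots> = real (Suc j) * ((real (Suc (Suc j)) - 2 * \<alpha>) * A_coef (Suc j) \<alpha>)"
    by (simp add: algebra_simps)
  also have "\<dots> = real (Suc j) * (real (Suc (Suc j)) * A_coef (Suc (Suc j)) \<alpha>)"
    using A_coef_Suc[of "Suc j" \<alpha>] by simp
  finally show ?case by simp
qed simp

section \<open>Distortion and coefficients in the class F\<close>

context
  fixes \<alpha> :: real and h g :: "complex \<Rightarrow> complex"
  assumes \<alpha>: "\<alpha> < 1" and F: "class_F \<alpha> h g"
begin

lemma class_F_holo: "h holomorphic_on ball 0 1" "g holomorphic_on ball 0 1"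
    "deriv h holomorphic_on ball 0 1" "deriv (deriv h) holomorphic_on ball 0 1" "deriv g holomorphic_on ball 0 1"
  using F holomorphic_deriv open_ball unfolding class_F_def by blast+

lemma class_F_nz: "z \<in> ball 0 1 \<Longrightarrow> deriv h z \<noteq> 0"
  using F unfolding class_F_def by blast

lemma class_F_Re: "z \<in> ball 0 1 \<Longrightarrow> Re (1 + z * deriv (deriv h) z / deriv h z) > \<alpha>"
  using F unfolding class_F_def by blast

lemma class_F_deriv_0: "deriv h 0 = 1"
  using F unfolding class_F_def by blast

text \<open>Along a radius the logarithmic derivative of \<open>|h'|\<close> is at least
  \<open>- c / (1 + t)\<close> with \<open>c = 2 (1 - \<alpha>)\<close>; comparison with
  \<open>(1 + t) powr (- c)\<close> gives the bound.\<close>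

lemma class_F_distortion:
  assumes z: "norm z < 1"
  shows "(1 + norm z) powr (- 2 * (1 - \<alpha>)) \<le> norm (deriv h z)"
proof (cases "z = 0")
  case False
  define r where "r = norm z"
  define \<zeta> where "\<zeta> = z / of_real r"
  define c where "c = 2 * (1 - \<alpha>)"
  have r: "0 < r" "r < 1" using False z by (auto simp: r_def)
  have \<zeta>: "norm \<zeta> = 1" "of_real r * \<zeta> = z" using r by (auto simp: \<zeta>_def norm_divide r_def)
  define q where "q z = (1 + z * deriv (deriv h) z / deriv h z - of_real \<alpha>) / of_real (1 - \<alpha>)" for z
  have "q holomorphic_on ball 0 1"
    unfolding q_def using class_F_holo class_F_nz \<alpha> by (intro holomorphic_intros) auto
  moreover have "q 0 = 1" using \<alpha> by (simp add: q_def)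
  moreover have Req: "Re (q z) = (Re (1 + z * deriv (deriv h) z / deriv h z) - \<alpha>) / (1 - \<alpha>)" for z
    unfolding q_def by (simp only: Re_divide_of_real minus_complex.sel Re_complex_of_real)
  then have "Re (q z) > 0" if "z \<in> ball 0 1" for z
    unfolding Req using class_F_Re[OF that] \<alpha> by simp
  ultimately have qge: "Re (q z) \<ge> (1 - norm z) / (1 + norm z)" if "norm z < 1" for z
    using that by (intro Re_ge_of_Re_pos) auto
  define V where "V t = deriv h (of_real t * \<zeta>)" for t :: real
  \<comment> \<open>Monotonicity of the squared quotient of \<open>|h'|\<close> by its lower bound
    replaces integrating a logarithmic derivative.\<close>
  define D where "D t = Re (cnj (V t) * V t) * (1 + t) powr (2 * c)" for t
  have "D 0 \<le> D r"
  proof (rule DERIV_nonneg_imp_increasing_open[of 0 r D])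
    show "0 \<le> r" using r by simp
    have dV: "(V has_vector_derivative deriv (deriv h) (of_real t * \<zeta>) * \<zeta>) (at t)" if t: "0 \<le> t" "t \<le> r" for t
    proof -
      have "((\<lambda>t. of_real t * \<zeta>) has_vector_derivative \<zeta>) (at t)"
        by (auto intro!: derivative_eq_intros simp: has_vector_derivative_def scaleR_conv_of_real)
      moreover have "(deriv h has_field_derivative deriv (deriv h) (of_real t * \<zeta>)) (at (of_real t * \<zeta>))"
        using holomorphic_derivI[OF class_F_holo(3) open_ball] t r \<zeta> by (simp add: norm_mult)
      ultimately show ?thesis
        using field_vector_diff_chain_at by (fastforce simp: V_def[abs_def] o_def mult.commute)
    qed
    have dD: "(D has_real_derivative (2 * Re (cnj (V t) * (deriv (deriv h) (of_real t * \<zeta>) * \<zeta>))) * (1 + t) powr (2 * c)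
         + Re (cnj (V t) * V t) * (2 * c * (1 + t) powr (2 * c - 1))) (at t)" if t: "0 \<le> t" "t \<le> r" for t
    proof -
      define W where "W = deriv (deriv h) (of_real t * \<zeta>) * \<zeta>"
      have "((\<lambda>t. cnj (V t) * V t) has_vector_derivative cnj (V t) * W + cnj W * V t) (at t)"
        unfolding W_def by (intro has_vector_derivative_mult has_vector_derivative_cnj dV t)
      then have "((\<lambda>t. Re (cnj (V t) * V t)) has_vector_derivative Re (cnj (V t) * W + cnj W * V t)) (at t)"
        by (rule bounded_linear.has_vector_derivative[OF bounded_linear_Re])
      then have 1: "((\<lambda>t. Re (cnj (V t) * V t)) has_real_derivative 2 * Re (cnj (V t) * W)) (at t)"
        by (simp add: has_real_derivative_iff_has_vector_derivative mult.commute)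
      have 2: "((\<lambda>t. (1 + t) powr (2 * c)) has_real_derivative 2 * c * (1 + t) powr (2 * c - 1)) (at t)"
        using t by (auto intro!: derivative_eq_intros)
      show ?thesis
        unfolding D_def[abs_def] W_def[symmetric]
        by (rule DERIV_cong[OF DERIV_mult[OF 1 2]]) (simp only: mult_ac add_ac)
    qed
    then show "continuous_on {0..r} D"
      by (meson DERIV_isCont atLeastAtMost_iff continuous_at_imp_continuous_on)
    fix t assume t: "0 < t" "t < r"
    define x where "x = of_real t * \<zeta>"
    have x: "norm x = t" "x \<in> ball 0 1" using t r \<zeta> by (auto simp: x_def norm_mult)
    have Vt: "V t = deriv h x" by (simp add: V_def x_def)
    have nz: "deriv h x \<noteq> 0" using class_F_nz x by auto
    define W where "W = deriv (deriv h) (of_real t * \<zeta>) * \<zeta>"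
    define P where "P = x * deriv (deriv h) x / deriv h x"
    \<comment> \<open>Solved for \<open>Re P\<close>, this is
      \<open>(1 - \<alpha>) * ((1 - t) / (1 + t) - 1) = - c * t / (1 + t)\<close>, the origin of the
      exponent \<open>c\<close>.\<close>
    have "(1 - t) / (1 + t) \<le> (1 + Re P - \<alpha>) / (1 - \<alpha>)"
      using qge[of x] x Req[of x] by (simp add: P_def)
    then have P: "- c * t / (1 + t) \<le> Re P" using t \<alpha> by (simp add: c_def field_simps)
    have "of_real t * (cnj (V t) * W) = (cnj (V t) * V t) * P"
      using nz by (simp add: Vt W_def P_def x_def mult_ac)
    also have "cnj (V t) * V t = of_real ((norm (V t))\<^sup>2)" by (metis complex_norm_square mult.commute)
    finally have eq: "of_real t * (cnj (V t) * W) = of_real ((norm (V t))\<^sup>2) * P" .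
    have Re_scale: "Re (of_real x * y) = x * Re y" for x y by simp
    have "t * Re (cnj (V t) * W) = (norm (V t))\<^sup>2 * Re P"
      using arg_cong[OF eq, of Re] by (simp only: Re_scale)
    moreover have "(norm (V t))\<^sup>2 * Re P \<ge> (norm (V t))\<^sup>2 * (- c * t / (1 + t))"
      using P by (intro mult_left_mono) auto
    ultimately have "t * Re (cnj (V t) * W) \<ge> t * (- ((norm (V t))\<^sup>2 * c / (1 + t)))"
      by (simp add: field_simps)
    then have 1: "Re (cnj (V t) * W) \<ge> - ((norm (V t))\<^sup>2 * c / (1 + t))" using t(1) by (rule mult_left_le_imp_le)
    have "(2 * Re (cnj (V t) * W)) * (1 + t) powr (2 * c) \<ge> (2 * - ((norm (V t))\<^sup>2 * c / (1 + t))) * (1 + t) powr (2 * c)"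
      using 1 by (intro mult_right_mono) auto
    moreover have "(1 + t) powr (2 * c - 1) = (1 + t) powr (2 * c) / (1 + t)" using t by (simp add: powr_diff)
    moreover have "Re (cnj (V t) * V t) = (norm (V t))\<^sup>2" 
      unfolding cmod_power2 by (simp add: power2_eq_square)
    ultimately have "(2 * Re (cnj (V t) * W)) * (1 + t) powr (2 * c)
         + Re (cnj (V t) * V t) * (2 * c * (1 + t) powr (2 * c - 1)) \<ge> 0" by (simp add: field_simps)
    then show "\<exists>y. (D has_real_derivative y) (at t) \<and> 0 \<le> y"
      using dD[of t] t unfolding W_def by fastforce
  qed
  moreover have "D 0 = 1" by (simp add: D_def V_def class_F_deriv_0)
  moreover have "D r = (norm (deriv h z) * (1 + r) powr c)\<^sup>2"
  proof -
    have "(1 + r) powr (2 * c) = ((1 + r) powr c)\<^sup>2"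
      by (simp add: power2_eq_square flip: powr_add)
    moreover have "Re (cnj w * w) = (norm w)\<^sup>2" for w
      unfolding cmod_power2 by (simp add: power2_eq_square)
    ultimately show ?thesis by (simp only: D_def V_def \<zeta>(2) power_mult_distrib)
  qed
  ultimately have "1\<^sup>2 \<le> (norm (deriv h z) * (1 + r) powr c)\<^sup>2" by simp
  then have "1 \<le> norm (deriv h z) * (1 + r) powr c" by (rule power2_le_imp_le) simp
  then have "(1 + r) powr (- c) \<le> norm (deriv h z)" using r by (simp add: powr_minus field_simps)
  then show ?thesis by (simp add: c_def r_def)
qed (simp add: class_F_deriv_0)

text \<open>The function \<open>f = 1 - \<alpha> + z h'' / h'\<close> has positive real part, so its
  coefficients are at most \<open>2 (1 - \<alpha>)\<close> in modulus. Comparing coefficients in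
  \<open>f h' = (1 - \<alpha>) h' + z h''\<close> expresses each coefficient of \<open>h'\<close> by
  earlier ones, and the majorants satisfy the same recursion with equality.\<close>

lemma class_F_coeff_deriv_le: "norm (taylor_coeff (deriv h) j) \<le> real (Suc j) * A_coef (Suc j) \<alpha>"
proof (induction j rule: less_induct)
  case (less j)
  define c where "c = taylor_coeff (deriv h)"
  define f where "f z = of_real (1 - \<alpha>) + z * deriv (deriv h) z / deriv h z" for z
  have hf: "f holomorphic_on ball 0 1"
    unfolding f_def using class_F_holo class_F_nz by (intro holomorphic_intros) auto
  define a where "a = taylor_coeff f"
  have a0: "a 0 = of_real (1 - \<alpha>)" by (simp add: a_def taylor_coeff_def f_def)
  have "Re (f z) > 0" if "z \<in> ball 0 1" for z
    using class_F_Re[OF that] by (simp add: f_def)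
  then have ak: "norm (a k) \<le> 2 * (1 - \<alpha>)" if "k \<ge> 1" for k
    using norm_taylor_coeff_le_Re_pos[OF hf _ that] by (simp add: a_def f_def)
  have c0: "c 0 = 1" by (simp add: c_def taylor_coeff_def class_F_deriv_0)
  have rec: "of_nat j * c j = (\<Sum>i=1..j. a i * c (j - i))"
  proof -
    have hx: "deriv h has_fps_expansion Abs_fps c"
      unfolding c_def by (rule has_fps_expansion_taylor[OF class_F_holo(3)])
    have fx: "f has_fps_expansion Abs_fps a"
      unfolding a_def by (rule has_fps_expansion_taylor[OF hf])
    have "(\<lambda>z. z * deriv (deriv h) z + of_real (1 - \<alpha>) * deriv h z) has_fps_expansion
        fps_X * fps_deriv (Abs_fps c) + fps_const (of_real (1 - \<alpha>)) * Abs_fps c"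
      by (intro fps_expansion_intros hx)
    moreover have "(\<lambda>z. f z * deriv h z) has_fps_expansion Abs_fps a * Abs_fps c"
      by (intro fps_expansion_intros hx fx)
    moreover have "\<forall>\<^sub>F z in nhds 0. f z * deriv h z = z * deriv (deriv h) z + of_real (1 - \<alpha>) * deriv h z"
    proof (rule eventually_nhds_in_open[THEN eventually_mono])
      show "open (ball (0::complex) 1)" "(0::complex) \<in> ball 0 1" by auto
      show "f z * deriv h z = z * deriv (deriv h) z + of_real (1 - \<alpha>) * deriv h z" if "z \<in> ball 0 1" for z
        using class_F_nz[OF that] by (simp add: f_def field_simps)
    qed
    ultimately have "fps_X * fps_deriv (Abs_fps c) + fps_const (of_real (1 - \<alpha>)) * Abs_fps c = Abs_fps a * Abs_fps c"
      using fps_expansion_unique_eventually by metis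
    then have "fps_nth (fps_X * fps_deriv (Abs_fps c) + fps_const (of_real (1 - \<alpha>)) * Abs_fps c) j
       = fps_nth (Abs_fps a * Abs_fps c) j" by simp
    moreover have "fps_nth (fps_X * fps_deriv (Abs_fps c) + fps_const (of_real (1 - \<alpha>)) * Abs_fps c) j
       = of_nat j * c j + of_real (1 - \<alpha>) * c j"
      by (cases j) simp_all
    moreover have "fps_nth (Abs_fps a * Abs_fps c) j = (\<Sum>i=0..j. a i * c (j - i))"
      by (simp add: fps_mult_nth)
    ultimately have "of_nat j * c j + of_real (1 - \<alpha>) * c j = (\<Sum>i=0..j. a i * c (j - i))" by metis
    \<comment> \<open>The term \<open>i = 0\<close> cancels against
      \<open>(1 - \<alpha>) * c j\<close>, so only coefficients of smaller index remain for the
      induction.\<close>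
    also have "\<dots> = a 0 * c j + (\<Sum>i=1..j. a i * c (j - i))"
      by (simp add: sum.atLeast_Suc_atMost)
    finally show ?thesis by (simp add: a0)
  qed
  show ?case
  proof (cases "j = 0")
    case True
    then show ?thesis using c0 by (simp add: c_def)
  next
    case False
    have "real j * norm (c j) = norm (\<Sum>i=1..j. a i * c (j - i))"
      unfolding rec[symmetric] by (simp add: norm_mult)
    also have "\<dots> \<le> (\<Sum>i=1..j. 2 * (1 - \<alpha>) * (real (Suc (j - i)) * A_coef (Suc (j - i)) \<alpha>))"
      using ak less \<alpha> unfolding c_def by (intro sum_norm_le) (auto simp: norm_mult intro!: mult_mono simp del: of_nat_Suc)
    also have "\<dots> = 2 * (1 - \<alpha>) * (\<Sum>i<j. real (Suc i) * A_coef (Suc i) \<alpha>)"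
      unfolding sum_distrib_left
      by (rule sum.reindex_bij_witness[of _ "\<lambda>i. j - i" "\<lambda>i. j - i"]) auto
    also have "\<dots> = real j * (real (Suc j) * A_coef (Suc j) \<alpha>)" by (simp only: A_coef_recursion)
    finally show ?thesis using False unfolding c_def by (simp del: of_nat_Suc)
  qed
qed

lemma class_F_coeff_h_le:
  assumes "k \<ge> 1" shows "norm (taylor_coeff h k) \<le> A_coef k \<alpha>"
proof -
  obtain j where j: "k = Suc j" using assms by (cases k) auto
  have "real (Suc j) * norm (taylor_coeff h (Suc j)) = norm (taylor_coeff (deriv h) j)"
    by (metis norm_mult norm_of_nat taylor_coeff_Suc)
  also have "\<dots> \<le> real (Suc j) * A_coef (Suc j) \<alpha>" by (rule class_F_coeff_deriv_le)
  finally show ?thesis by (simp add: j del: of_nat_Suc)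
qed

text \<open>The dilatation relation gives \<open>k |b_k| = (k - 1) |a_(k-1)|\<close>; the
  denominator arises from rewriting \<open>A_(k-1)\<close> in terms of \<open>A_k\<close>.\<close>

lemma class_F_coeff_g_le:
  assumes "k \<ge> 2" shows "norm (taylor_coeff g k) \<le> (real k - 1) / (real k - 2 * \<alpha>) * A_coef k \<alpha>"
proof -
  obtain j where j: "k = Suc (Suc j)" using assms by (metis Suc_le_D numeral_2_eq_2 Suc_le_mono)
  obtain \<theta> :: real where \<theta>: "\<And>z. z \<in> ball 0 1 \<Longrightarrow> deriv g z = exp (\<i> * of_real \<theta>) * z * deriv h z"
    using F unfolding class_F_def by blast
  have "deriv g has_fps_expansion Abs_fps (taylor_coeff (deriv g))"
    by (rule has_fps_expansion_taylor[OF class_F_holo(5)])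
  moreover have "(\<lambda>z. exp (\<i> * of_real \<theta>) * z * deriv h z) has_fps_expansion
      fps_const (exp (\<i> * of_real \<theta>)) * fps_X * Abs_fps (taylor_coeff (deriv h))"
    by (intro fps_expansion_intros has_fps_expansion_taylor class_F_holo)
  moreover have "\<forall>\<^sub>F z in nhds 0. deriv g z = exp (\<i> * of_real \<theta>) * z * deriv h z"
    by (rule eventually_nhds_in_open[THEN eventually_mono, of "ball 0 1"]) (use \<theta> in auto)
  ultimately have "Abs_fps (taylor_coeff (deriv g)) = fps_const (exp (\<i> * of_real \<theta>)) * fps_X * Abs_fps (taylor_coeff (deriv h))"
    by (rule fps_expansion_unique_eventually)
  from arg_cong[OF this, of "\<lambda>f. fps_nth f (Suc j)"]
  have "taylor_coeff (deriv g) (Suc j) = exp (\<i> * of_real \<theta>) * taylor_coeff (deriv h) j"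
    by (simp add: mult.assoc)
  then have "norm (of_nat k * taylor_coeff g k) = norm (exp (\<i> * of_real \<theta>) * taylor_coeff (deriv h) j)"
    unfolding j by (simp add: taylor_coeff_Suc del: of_nat_Suc)
  then have "real k * norm (taylor_coeff g k) = norm (taylor_coeff (deriv h) j)"
    by (simp add: norm_mult)
  also have "\<dots> \<le> (real k - 1) * A_coef (Suc j) \<alpha>" using class_F_coeff_deriv_le[of j] by (simp add: j)
  also have "A_coef (Suc j) \<alpha> = real k * A_coef k \<alpha> / (real k - 2 * \<alpha>)"
    using A_coef_Suc[of "Suc j" \<alpha>] \<alpha> by (simp add: j field_simps)
  finally have "real k * norm (taylor_coeff g k) \<le> real k * ((real k - 1) / (real k - 2 * \<alpha>) * A_coef k \<alpha>)"
    by (simp add: mult_ac)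
  then show ?thesis using assms by (subst (asm) mult_le_cancel_left_pos) auto
qed

end

section \<open>The function \<open>\<psi>\<close> and its least zero\<close>

lemma one_plus_powr_le:
  fixes x s :: real assumes "0 \<le> x" "0 \<le> s" "s \<le> 1"
  shows "(1 + x) powr s \<le> 1 + s * x"
proof -
  have "exp ((1 - s) *\<^sub>R 0 + s *\<^sub>R ln (1 + x)) \<le> (1 - s) * exp 0 + s * exp (ln (1 + x))"
    using assms by (intro convex_onD[OF exp_convex]) auto
  then show ?thesis using assms by (simp add: powr_def algebra_simps)
qed

text \<open>Bernoulli's inequality covers exponents up to 1; beyond that, one factor
  \<open>1 + x\<close> is first absorbed into \<open>1 - x\<close> to form
  \<open>1 - x^2\<close>.\<close>

lemma one_minus_times_one_plus_powr_le:
  fixes x s :: real assumes x: "0 \<le> x" "x \<le> 1" and s: "0 \<le> s" "s \<le> 2"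
  shows "(1 - x) * (1 + x) powr s \<le> 1 + (s - 1) * x"
proof (cases "s \<le> 1")
  case True
  have "(1 - x) * (1 + x) powr s \<le> (1 - x) * (1 + s * x)"
    using x s True by (intro mult_left_mono one_plus_powr_le) auto
  also have "\<dots> = 1 + (s - 1) * x - s * x\<^sup>2" by (simp add: algebra_simps power2_eq_square)
  also have "\<dots> \<le> 1 + (s - 1) * x" using s by simp
  finally show ?thesis .
next
  case False
  have "(1 - x) * (1 + x) powr s = (1 - x\<^sup>2) * (1 + x) powr (s - 1)"
    using x by (simp add: powr_diff field_simps power2_eq_square)
  also have "\<dots> \<le> (1 - x\<^sup>2) * (1 + (s - 1) * x)"
    using x s False by (intro mult_left_mono one_plus_powr_le) (auto simp: power_le_one)
  also have "\<dots> \<le> 1 * (1 + (s - 1) * x)"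
    using x False by (intro mult_right_mono) auto
  finally show ?thesis by simp
qed

lemma L_fun_integrable:
  assumes "0 \<le> a"
  shows "(\<lambda>\<rho>. (1 - \<rho>) * (1 + \<rho>) powr (- 2 * (1 - \<alpha>))) integrable_on {a..b::real}"
  using assms by (intro integrable_continuous_real continuous_intros) auto

text \<open>The bound is compared with L by derivatives. After division by the common factor
  \<open>(1 + x) powr (- e - 1)\<close>, the inequality between integrands is the preceding lemma
  with exponent \<open>2 - e\<close>.\<close>

lemma L_fun_le:
  assumes r: "0 \<le> r" "r < 1" and \<alpha>: "0 \<le> \<alpha>" "\<alpha> < 1"
  shows "L_fun r \<alpha> \<le> r * (1 + r) powr (- (3 - 2 * \<alpha>) / 2)"
proof -
  define e where "e = (3 - 2 * \<alpha>) / 2"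
  have e: "1 / 2 < e" "e \<le> 3 / 2" using \<alpha> by (auto simp: e_def)
  define G where "G x = x * (1 + x) powr (- e)" for x :: real
  define G' where "G' x = (1 + x) powr (- e) - e * x * (1 + x) powr (- e - 1)" for x :: real
  have "(G has_real_derivative G' x) (at x)" if "0 \<le> x" for x
    unfolding G_def G'_def using that by (auto intro!: derivative_eq_intros)
  then have I: "(G' has_integral (G r - G 0)) {0..r}"
    using r by (intro fundamental_theorem_of_calculus)
      (auto simp flip: has_real_derivative_iff_has_vector_derivative intro: DERIV_subset)
  have "L_fun r \<alpha> \<le> integral {0..r} G'"
    unfolding L_fun_def
  proof (rule integral_le)
    show "G' integrable_on {0..r}" using I by blast
    fix x assume x: "x \<in> {0..r}"
    have p: "(1 + x) powr (- 2 * (1 - \<alpha>)) = (1 + x) powr (- e - 1) * (1 + x) powr (2 - e)"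
    proof -
      have "- 2 * (1 - \<alpha>) = (- e - 1) + (2 - e)" by (simp add: e_def field_simps)
      then show ?thesis by (simp only: powr_add)
    qed
    have "(1 - x) * (1 + x) powr (- 2 * (1 - \<alpha>)) = (1 + x) powr (- e - 1) * ((1 - x) * (1 + x) powr (2 - e))"
      unfolding p by simp
    also have "\<dots> \<le> (1 + x) powr (- e - 1) * (1 + (2 - e - 1) * x)"
      using x r e by (intro mult_left_mono one_minus_times_one_plus_powr_le) auto
    also have "\<dots> = G' x"
    proof -
      have "(1 + x) powr (- e) = (1 + x) powr (- e - 1) * (1 + x)"
        using x by (simp add: powr_diff)
      then show ?thesis unfolding G'_def by (simp add: algebra_simps)
    qed
    finally show "(1 - x) * (1 + x) powr (- 2 * (1 - \<alpha>)) \<le> G' x" .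
  qed (rule L_fun_integrable, simp)
  also have "\<dots> = r * (1 + r) powr (- e)" using integral_unique[OF I] by (simp add: G_def)
  finally show ?thesis unfolding e_def by (simp only: minus_divide_left)
qed

lemma L_fun_ge:
  assumes r: "0 \<le> r" "r < 1" and \<alpha>: "0 \<le> \<alpha>" "\<alpha> < 1"
  shows "r * ((1 - r) * (1 + r) powr - 2) \<le> L_fun r \<alpha>"
proof -
  have "integral {0..r} (\<lambda>_. (1 - r) * (1 + r) powr - 2) \<le> L_fun r \<alpha>"
    unfolding L_fun_def
  proof (rule integral_le)
    fix x assume x: "x \<in> {0..r}"
    have "(1 + r) powr - 2 \<le> (1 + x) powr - 2" using x by (intro powr_mono2') auto
    also have "\<dots> \<le> (1 + x) powr (- 2 * (1 - \<alpha>))" using x \<alpha> by (intro powr_mono) auto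
    finally show "(1 - r) * (1 + r) powr - 2 \<le> (1 - x) * (1 + x) powr (- 2 * (1 - \<alpha>))"
      using x r by (intro mult_mono) auto
  qed (use L_fun_integrable in auto)
  then show ?thesis using r by (simp add: mult_ac)
qed

lemma L_fun_nonneg:
  assumes "0 \<le> r" "r < 1" "0 \<le> \<alpha>" "\<alpha> < 1"
  shows "0 \<le> L_fun r \<alpha>"
  using order_trans[OF _ L_fun_ge[OF assms]] assms by simp

lemma A_fun_le:
  assumes r: "0 < r" "r < 1" and \<alpha>: "0 \<le> \<alpha>" "\<alpha> < 1"
  shows "A_fun r \<alpha> \<le> (1 - r) * (1 + r) powr (- 2 * (1 - \<alpha>))"
proof -
  have "(L_fun r \<alpha>)\<^sup>2 \<le> (r * (1 + r) powr (- (3 - 2 * \<alpha>) / 2))\<^sup>2"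
    using r \<alpha> by (intro power_mono L_fun_le L_fun_nonneg) auto
  also have "\<dots> = r\<^sup>2 * (1 + r) powr (- (3 - 2 * \<alpha>))"
    using r by (simp add: power_mult_distrib power2_eq_square flip: powr_add)
  also have "(1 + r) powr (- (3 - 2 * \<alpha>)) = (1 + r) powr (- 2 * (1 - \<alpha>)) / (1 + r)"
  proof -
    have "- (3 - 2 * \<alpha>) = - 2 * (1 - \<alpha>) - 1" by simp
    then show ?thesis using r by (simp only: powr_diff) simp
  qed
  finally have "(L_fun r \<alpha>)\<^sup>2 \<le> r\<^sup>2 * ((1 + r) powr (- 2 * (1 - \<alpha>)) / (1 + r))" .
  then have "A_fun r \<alpha> \<le> (1 - r\<^sup>2) / r\<^sup>2 * (r\<^sup>2 * ((1 + r) powr (- 2 * (1 - \<alpha>)) / (1 + r)))"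
    unfolding A_fun_def using r by (intro mult_left_mono) (auto simp: power_le_one)
  also have "\<dots> = (1 - r\<^sup>2) / (1 + r) * (1 + r) powr (- 2 * (1 - \<alpha>))" using r by simp
  also have "(1 - r\<^sup>2) / (1 + r) = 1 - r" using r by (simp add: field_simps power2_eq_square)
  finally show ?thesis .
qed

text \<open>Any positive bound independent of \<open>r\<close> serves to make \<open>psi\<close>
  positive near 0. Here \<open>L / r \<ge> 2/9\<close> and \<open>1 - r^2 \<ge> 3/4\<close>, and
  \<open>3/4 * 4/81 = 1/27\<close>.\<close>

lemma A_fun_ge:
  assumes r: "0 < r" "r \<le> 1 / 2" and \<alpha>: "0 \<le> \<alpha>" "\<alpha> < 1"
  shows "1 / 27 \<le> A_fun r \<alpha>"
proof -
  have "r * ((1 - 1/2) * (1 + 1/2) powr - 2) \<le> r * ((1 - r) * (1 + r) powr - 2)"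
    using r by (intro mult_mono powr_mono2') auto
  also have "\<dots> \<le> L_fun r \<alpha>" using r \<alpha> by (intro L_fun_ge) auto
  also have "(1 - 1/2) * (1 + 1/2) powr - 2 = (2 / 9 :: real)" by (simp add: powr_minus power2_eq_square)
  finally have "(r * (2 / 9))\<^sup>2 \<le> (L_fun r \<alpha>)\<^sup>2" using r by (intro power_mono) auto
  then have "4 / 81 \<le> (L_fun r \<alpha>)\<^sup>2 / r\<^sup>2" using r by (simp add: power_mult_distrib field_simps power2_eq_square)
  moreover have "r\<^sup>2 \<le> (1 / 2)\<^sup>2" using r by (intro power_mono) auto
  ultimately have "(3 / 4) * (4 / 81) \<le> (1 - r\<^sup>2) * ((L_fun r \<alpha>)\<^sup>2 / r\<^sup>2)"
    by (intro mult_mono) (auto simp: power2_eq_square)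
  then show ?thesis by (simp add: A_fun_def)
qed

lemma continuous_on_A_fun: "continuous_on {0<..<1} (\<lambda>r. A_fun r \<alpha>)"
proof -
  have "continuous_on {0..1} (\<lambda>r. L_fun r \<alpha>)"
    unfolding L_fun_def by (rule indefinite_integral_continuous_1[OF L_fun_integrable]) simp
  then have "continuous_on {0<..<1} (\<lambda>r. L_fun r \<alpha>)" by (rule continuous_on_subset) auto
  then show ?thesis unfolding A_fun_def by (intro continuous_intros) auto
qed

section \<open>Tails of power series whose coefficients grow at most linearly\<close>

context
  fixes a :: "nat \<Rightarrow> real" and n :: nat
  assumes a: "\<And>k. k \<ge> 2 \<Longrightarrow> 0 \<le> a k \<and> a k \<le> real k" and n: "n \<ge> 1"
begin

lemma tail_series_summable0: "\<bar>x\<bar> < 1 \<Longrightarrow> summable (\<lambda>i. a (i + n + 1) * x ^ i)"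
proof (rule summable_comparison_test')
  assume x: "\<bar>x\<bar> < 1"
  have "summable (\<lambda>i. of_nat (Suc i) * \<bar>x\<bar> ^ i)"
    using geometric_deriv_sums[of "\<bar>x\<bar>"] x by (auto simp: sums_iff)
  then show "summable (\<lambda>i. real (n + 1) * (of_nat (Suc i) * \<bar>x\<bar> ^ i))" by (rule summable_mult)
  fix i :: nat
  have "a (i + n + 1) \<le> real (n + 1) * real (Suc i)"
    using a[of "i + n + 1"] n by (auto simp: algebra_simps intro: order_trans)
  then have "a (i + n + 1) * \<bar>x\<bar> ^ i \<le> real (n + 1) * real (Suc i) * \<bar>x\<bar> ^ i"
    by (intro mult_right_mono) auto
  then show "norm (a (i + n + 1) * x ^ i) \<le> real (n + 1) * (of_nat (Suc i) * \<bar>x\<bar> ^ i)"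
    using a[of "i + n + 1"] n by (simp add: abs_mult power_abs mult.assoc)
qed

lemma tail_series_eq:
  assumes "\<bar>x\<bar> < 1"
  shows "summable (\<lambda>i. a (i + n + 1) * x ^ (i + n))"
    and "(\<Sum>i. a (i + n + 1) * x ^ (i + n)) = x ^ n * (\<Sum>i. a (i + n + 1) * x ^ i)"
  using summable_mult[OF tail_series_summable0[OF assms], of "x ^ n"]
    suminf_mult[OF tail_series_summable0[OF assms], of "x ^ n"]
  by (simp_all add: power_add mult_ac)

text \<open>Factoring out \<open>x ^ n\<close> leaves an ordinary power series, to which the
  standard continuity theorem applies.\<close>

lemma isCont_tail_series:
  assumes "\<bar>x\<bar> < 1"
  shows "isCont (\<lambda>x. \<Sum>i. a (i + n + 1) * x ^ (i + n)) x"
proof -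
  define K where "K = (1 + \<bar>x\<bar>) / 2"
  have "isCont (\<lambda>x. \<Sum>i. a (i + n + 1) * x ^ i) x"
    using assms by (intro isCont_powser[of _ K] tail_series_summable0) (auto simp: K_def)
  then have "isCont (\<lambda>x. x ^ n * (\<Sum>i. a (i + n + 1) * x ^ i)) x" by (intro continuous_intros)
  moreover have "\<forall>\<^sub>F y in nhds x. y ^ n * (\<Sum>i. a (i + n + 1) * y ^ i) = (\<Sum>i. a (i + n + 1) * y ^ (i + n))"
  proof (rule eventually_nhds_in_open[THEN eventually_mono, of "{-1<..<1}"])
    fix y :: real assume "y \<in> {-1<..<1}"
    then show "y ^ n * (\<Sum>i. a (i + n + 1) * y ^ i) = (\<Sum>i. a (i + n + 1) * y ^ (i + n))"
      by (intro tail_series_eq(2)[symmetric]) auto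
  qed (use assms in auto)
  ultimately show ?thesis by (subst isCont_cong[symmetric])
qed

lemma tail_series_tendsto_0: "((\<lambda>x. \<Sum>i. a (i + n + 1) * x ^ (i + n)) \<longlongrightarrow> 0) (at_right 0)"
proof -
  have "((\<lambda>x. \<Sum>i. a (i + n + 1) * x ^ (i + n)) \<longlongrightarrow> (\<Sum>i. a (i + n + 1) * 0 ^ (i + n))) (at 0)"
    using isCont_tail_series[of 0] by (simp add: isCont_def)
  moreover have "(\<Sum>i. a (i + n + 1) * 0 ^ (i + n)) = 0" using n by (simp add: power_0_left)
  ultimately show ?thesis by (auto intro: filterlim_mono at_le)
qed

lemma tail_series_ge:
  assumes "0 \<le> x" "x < 1"
  shows "a (n + 1) * x ^ n \<le> (\<Sum>i. a (i + n + 1) * x ^ (i + n))"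
proof -
  have "(\<Sum>i\<in>{0}. a (i + n + 1) * x ^ (i + n)) \<le> (\<Sum>i. a (i + n + 1) * x ^ (i + n))"
    using assms a n by (intro sum_le_suminf tail_series_eq(1)) auto
  then show ?thesis by simp
qed

end

section \<open>The majorants occurring in the two tails\<close>

lemma A_coef_le_1:
  assumes "0 \<le> \<alpha>" "\<alpha> < 1" "k \<ge> 1" shows "A_coef k \<alpha> \<le> 1"
  using assms(3)
proof (induction k rule: dec_induct)
  case (step k)
  have "real (Suc k) * A_coef (Suc k) \<alpha> \<le> real (Suc k) * 1"
    unfolding A_coef_Suc[OF step(1)]
    using step assms A_coef_pos[OF assms(2), of k] by (intro mult_mono) auto
  then show ?case by (simp del: of_nat_Suc)
qed simp

abbreviation (input) h_majorant :: "real \<Rightarrow> nat \<Rightarrow> real" where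
  "h_majorant \<alpha> k \<equiv> real k * A_coef k \<alpha>"

abbreviation (input) g_majorant :: "real \<Rightarrow> nat \<Rightarrow> real" where
  "g_majorant \<alpha> k \<equiv> real k * (real k - 1) / (real k - 2 * \<alpha>) * A_coef k \<alpha>"

lemma h_majorant_pos: "\<alpha> < 1 \<Longrightarrow> k \<ge> 1 \<Longrightarrow> 0 < h_majorant \<alpha> k"
  using A_coef_pos by simp

lemma h_majorant_bounds:
  assumes "0 \<le> \<alpha>" "\<alpha> < 1" "k \<ge> 2"
  shows "0 \<le> h_majorant \<alpha> k \<and> h_majorant \<alpha> k \<le> real k"
  using A_coef_pos[OF assms(2), of k] A_coef_le_1[OF assms(1,2), of k] assms(3)
  by (auto intro: mult_left_le)

text \<open>The recursion for \<open>A_coef\<close> cancels the denominator, which is small for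
  \<open>k = 2\<close> and \<open>\<alpha>\<close> near 1: the majorant is
  \<open>(k - 1) A_(k-1)\<close>.\<close>

lemma g_majorant_bounds:
  assumes "0 \<le> \<alpha>" "\<alpha> < 1" "k \<ge> 2"
  shows "0 \<le> g_majorant \<alpha> k \<and> g_majorant \<alpha> k \<le> real k"
proof -
  obtain j where j: "k = Suc j" "j \<ge> 1" using assms(3) by (cases k) auto
  have pos: "real k - 2 * \<alpha> > 0" using assms by auto
  have "real k * A_coef k \<alpha> / (real k - 2 * \<alpha>) = A_coef j \<alpha>"
    using A_coef_Suc[OF j(2), of \<alpha>] pos by (simp add: j(1) field_simps)
  then have eq: "g_majorant \<alpha> k = real j * A_coef j \<alpha>"
    using j by (metis add_diff_cancel_left' mult.assoc mult.commute of_nat_Suc times_divide_eq_left)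
  have "real j * A_coef j \<alpha> \<le> real j * 1"
    using A_coef_le_1[OF assms(1,2) j(2)] by (intro mult_left_mono) auto
  also have "\<dots> \<le> real k" using j by simp
  finally show ?thesis unfolding eq using A_coef_pos[OF assms(2), of j] by simp
qed

lemma psi_eq: "psi n m r \<alpha> = A_fun r \<alpha> - (\<Sum>i. h_majorant \<alpha> (i + n + 1) * r ^ (i + n))
    - (\<Sum>i. g_majorant \<alpha> (i + m + 1) * r ^ (i + m))"
  by (simp add: psi_def Let_def)

text \<open>Positivity near 0 keeps the zeros away from 0, so those up to \<open>b\<close> form a
  compact set with a minimum; the intermediate value theorem shows that it is nonempty and that no
  sign change precedes its minimum.\<close>

lemma least_zero:
  fixes f :: "real \<Rightarrow> real"
  assumes cont: "continuous_on {0<..<1} f" and ev: "eventually (\<lambda>x. f x > 0) (at_right 0)"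
    and neg: "0 < b" "b < 1" "f b < 0"
  defines "z \<equiv> LEAST r. r \<in> {0<..<1} \<and> f r = 0"
  shows "0 < z" "z < 1" "f z = 0" "\<And>r. 0 < r \<Longrightarrow> r < z \<Longrightarrow> f r > 0"
proof -
  obtain e where e: "0 < e" "\<And>x. 0 < x \<Longrightarrow> x < e \<Longrightarrow> f x > 0"
    using ev unfolding eventually_at_right_field by auto
  have eb: "e \<le> b" using e(2)[of b] neg by linarith
  \<comment> \<open>The left end is \<open>e/2\<close> rather than \<open>e\<close>, since
    positivity is known only strictly below \<open>e\<close>.\<close>
  define Z where "Z = {x \<in> {e/2..b}. f x = 0}"
  have sub: "{e/2..b} \<subseteq> {0<..<1}" using e neg by auto
  have ivt: "\<exists>x\<in>{e/2..c}. f x = 0" if "e \<le> c" "c < 1" "f c \<le> 0" for c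
  proof -
    have "continuous_on {e/2..c} f" using cont by (rule continuous_on_subset) (use that e in auto)
    moreover have "f (e/2) \<ge> 0" using e(1) e(2)[of "e/2"] by simp
    ultimately have "\<exists>x\<ge>e/2. x \<le> c \<and> f x = 0"
      using that e(1) by (intro IVT2') auto
    then show ?thesis by auto
  qed
  have "compact Z"
  proof -
    have "closed Z" unfolding Z_def
      by (intro continuous_closed_preimage_constant continuous_on_subset[OF cont sub]) auto
    moreover have "bounded Z" unfolding Z_def by (rule bounded_subset[of "{e/2..b}"]) auto
    ultimately show ?thesis by (simp add: compact_eq_bounded_closed)
  qed
  moreover have "Z \<noteq> {}" using ivt[OF eb] neg by (auto simp: Z_def)
  ultimately obtain y where y: "y \<in> Z" "\<And>x. x \<in> Z \<Longrightarrow> y \<le> x" by (meson compact_attains_inf)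
  have low: "y \<le> x" if "x \<in> {0<..<1}" "f x = 0" for x
  proof (cases "x \<le> b")
    case True
    have "x \<ge> e" using e(2)[of x] that by (metis greaterThanLessThan_iff less_irrefl not_le)
    then show ?thesis using that True e by (intro y(2)) (auto simp: Z_def)
  next
    case False
    then show ?thesis using y(1) by (auto simp: Z_def)
  qed
  have yz: "z = y" unfolding z_def
    using y(1) sub low by (intro Least_equality) (auto simp: Z_def)
  show "0 < z" "z < 1" "f z = 0" using y(1) sub by (auto simp: yz Z_def)
  show "f r > 0" if r: "0 < r" "r < z" for r
  proof (rule ccontr)
    assume "\<not> f r > 0"
    moreover from this have "e \<le> r" using e(2)[of r] r by linarith
    moreover have "r < 1" using r \<open>z < 1\<close> by simp
    ultimately obtain x where "x \<in> {e/2..r}" "f x = 0" using ivt[of r] by auto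
    then show False using low[of x] r \<open>r < 1\<close> e by (auto simp: yz)
  qed
qed

section \<open>Sign of \<open>psi\<close> and its first zero\<close>

context
  fixes \<alpha> :: real and n m :: nat
  assumes \<alpha>: "0 \<le> \<alpha>" "\<alpha> < 1" and n: "n \<ge> 2" and m: "m \<ge> 2"
begin

private lemma n_ge_1: "n \<ge> 1" and m_ge_1: "m \<ge> 1" using n m by auto

lemma psi_continuous: "continuous_on {0<..<1} (\<lambda>r. psi n m r \<alpha>)"
proof -
  have "continuous_on {0<..<1} (\<lambda>r. \<Sum>i. h_majorant \<alpha> (i + n + 1) * r ^ (i + n))"
    using isCont_tail_series[of "h_majorant \<alpha>" n, OF h_majorant_bounds[OF \<alpha>] n_ge_1] by (intro continuous_at_imp_continuous_on) auto
  moreover have "continuous_on {0<..<1} (\<lambda>r. \<Sum>i. g_majorant \<alpha> (i + m + 1) * r ^ (i + m))"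
    using isCont_tail_series[of "g_majorant \<alpha>" m, OF g_majorant_bounds[OF \<alpha>] m_ge_1] by (intro continuous_at_imp_continuous_on) auto
  ultimately show ?thesis
    unfolding psi_eq by (intro continuous_on_diff continuous_on_A_fun)
qed

lemma psi_pos_near_0: "eventually (\<lambda>r. psi n m r \<alpha> > 0) (at_right 0)"
proof -
  have t: "((\<lambda>r. (\<Sum>i. h_majorant \<alpha> (i + n + 1) * r ^ (i + n)) + (\<Sum>i. g_majorant \<alpha> (i + m + 1) * r ^ (i + m))) \<longlongrightarrow> 0 + 0) (at_right 0)"
    by (intro tendsto_add tail_series_tendsto_0 h_majorant_bounds \<alpha> g_majorant_bounds \<alpha> n_ge_1 m_ge_1)
  have "eventually (\<lambda>r. (\<Sum>i. h_majorant \<alpha> (i + n + 1) * r ^ (i + n)) + (\<Sum>i. g_majorant \<alpha> (i + m + 1) * r ^ (i + m)) < 1 / 27) (at_right 0)"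
    by (rule order_tendstoD(2)[OF t]) simp
  moreover have "eventually (\<lambda>r::real. r \<in> {0<..<1/2}) (at_right 0)"
    by (rule eventually_at_right_real) simp
  ultimately show ?thesis
  proof eventually_elim
    case (elim r)
    then show ?case using A_fun_ge[of r \<alpha>] \<alpha> unfolding psi_eq by auto
  qed
qed

text \<open>Near 1, \<open>A\<close> is at most \<open>1 - r\<close>, while the first term of the
  \<open>h\<close> tail tends to a positive number. Working with that one term avoids the behaviour
  of the full series at 1.\<close>

lemma psi_neg_near_1: "\<exists>b. 0 < b \<and> b < 1 \<and> psi n m b \<alpha> < 0"
proof -
  have "((\<lambda>r. (1 - r) - h_majorant \<alpha> (n + 1) * r ^ n) \<longlongrightarrow> (1 - 1) - h_majorant \<alpha> (n + 1) * 1 ^ n) (at_left 1)"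
    by (intro tendsto_intros)
  moreover have "(1 - 1) - h_majorant \<alpha> (n + 1) * 1 ^ n < 0" using h_majorant_pos[OF \<alpha>(2), of "n + 1"] n by simp
  ultimately have "eventually (\<lambda>r. (1 - r) - h_majorant \<alpha> (n + 1) * r ^ n < 0) (at_left 1)"
    by (rule order_tendstoD(2))
  moreover have "eventually (\<lambda>r::real. r \<in> {0<..<1}) (at_left 1)"
    by (rule eventually_at_left_real) simp
  ultimately have "eventually (\<lambda>b. 0 < b \<and> b < 1 \<and> psi n m b \<alpha> < 0) (at_left 1)"
  proof eventually_elim
    case (elim b)
    have "A_fun b \<alpha> \<le> (1 - b) * (1 + b) powr (- 2 * (1 - \<alpha>))" using elim \<alpha> by (intro A_fun_le) auto
    also have "\<dots> \<le> (1 - b) * (1 + b) powr 0" using elim \<alpha> by (intro mult_left_mono powr_mono) auto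
    finally have "A_fun b \<alpha> \<le> 1 - b" using elim by simp
    moreover have "h_majorant \<alpha> (n + 1) * b ^ n \<le> (\<Sum>i. h_majorant \<alpha> (i + n + 1) * b ^ (i + n))"
      using elim by (intro tail_series_ge h_majorant_bounds \<alpha> n_ge_1) auto
    moreover have "0 \<le> (\<Sum>i. g_majorant \<alpha> (i + m + 1) * b ^ (i + m))"
    proof (intro suminf_nonneg tail_series_eq(1)[of "g_majorant \<alpha>" m b] g_majorant_bounds \<alpha> m_ge_1)
      show "0 \<le> g_majorant \<alpha> (i + m + 1) * b ^ (i + m)" for i
        using elim m by (intro mult_nonneg_nonneg[OF conjunct1[OF g_majorant_bounds[OF \<alpha>]]]) auto
    qed (use elim in auto)
    ultimately show ?case using elim unfolding psi_eq by auto
  qed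
  then show ?thesis by (metis (mono_tags, lifting) eventually_happens trivial_limit_at_left_real)
qed

lemma r_nm:
  shows "0 < r_nm n m \<alpha>" "r_nm n m \<alpha> < 1" "psi n m (r_nm n m \<alpha>) \<alpha> = 0"
    and "\<And>r. 0 < r \<Longrightarrow> r < r_nm n m \<alpha> \<Longrightarrow> psi n m r \<alpha> > 0"
proof -
  obtain b where b: "0 < b" "b < 1" "psi n m b \<alpha> < 0" using psi_neg_near_1 by blast
  note * = least_zero[OF psi_continuous psi_pos_near_0 b, folded r_nm_def]
  show "0 < r_nm n m \<alpha>" "r_nm n m \<alpha> < 1" "psi n m (r_nm n m \<alpha>) \<alpha> = 0" by (fact *)+
  show "psi n m r \<alpha> > 0" if "0 < r" "r < r_nm n m \<alpha>" for r using *(4) that .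
qed

end

section \<open>Univalence\<close>

lemma norm_power_diff_le:
  fixes z w :: complex
  assumes "norm z \<le> r" "norm w \<le> r"
  shows "norm (z ^ k - w ^ k) \<le> real k * r ^ (k - 1) * norm (z - w)"
proof (rule field_differentiable_bound[OF convex_cball[of 0 r]])
  fix x :: complex assume x: "x \<in> cball 0 r"
  show "((\<lambda>x. x ^ k) has_field_derivative of_nat k * x ^ (k - 1)) (at x within cball 0 r)"
    by (auto intro!: derivative_eq_intros)
  show "norm (of_nat k * x ^ (k - 1)) \<le> real k * r ^ (k - 1)"
    using x by (auto simp: norm_mult norm_power intro!: mult_left_mono power_mono)
qed (use assms in auto)

text \<open>On the closed disk \<open>z ^ k\<close> is Lipschitz with constant
  \<open>k * r ^ (k - 1)\<close>; this accounts for the extra factor \<open>k\<close> in both sums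
  of \<open>psi\<close>.\<close>

lemma norm_taylor_remainder_diff_le:
  assumes hol: "f holomorphic_on ball 0 1" and f0: "f 0 = 0"
    and a: "\<And>k. k > n \<Longrightarrow> real k * norm (taylor_coeff f k) \<le> a k"
    and sm: "summable (\<lambda>i. a (i + n + 1) * r ^ (i + n))"
    and zw: "norm z \<le> r" "norm w \<le> r" and r: "r < 1"
  shows "norm ((f z - (\<Sum>k=1..n. taylor_coeff f k * z ^ k)) - (f w - (\<Sum>k=1..n. taylor_coeff f k * w ^ k)))
     \<le> (\<Sum>i. a (i + n + 1) * r ^ (i + n)) * norm (z - w)"
proof -
  define c where "c = taylor_coeff f"
  have r0: "0 \<le> r" using zw norm_ge_zero order_trans by blast
  have c0: "c 0 = 0" by (simp add: c_def taylor_coeff_def f0)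
  have S: "(\<lambda>i. c (i + (n + 1)) * x ^ (i + (n + 1))) sums (f x - (\<Sum>k=1..n. c k * x ^ k))" if "norm x \<le> r" for x
  proof -
    have "(\<lambda>k. c k * x ^ k) sums f x"
      using holomorphic_power_series[OF hol, of x] that r by (simp add: c_def taylor_coeff_def)
    then have "(\<lambda>i. c (i + (n + 1)) * x ^ (i + (n + 1))) sums (f x - (\<Sum>k<n+1. c k * x ^ k))"
      by (rule sums_split_initial_segment)
    moreover have "(\<Sum>k<n+1. c k * x ^ k) = (\<Sum>k=1..n. c k * x ^ k)"
      using c0 by (intro sum.mono_neutral_right) (auto simp: Suc_le_eq intro: gr0I)
    ultimately show ?thesis by simp
  qed
  have D: "(\<lambda>i. c (i + (n + 1)) * z ^ (i + (n + 1)) - c (i + (n + 1)) * w ^ (i + (n + 1))) sums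
      ((f z - (\<Sum>k=1..n. c k * z ^ k)) - (f w - (\<Sum>k=1..n. c k * w ^ k)))"
    by (intro sums_diff S zw)
  have "norm (\<Sum>i. c (i + (n + 1)) * z ^ (i + (n + 1)) - c (i + (n + 1)) * w ^ (i + (n + 1)))
      \<le> (\<Sum>i. a (i + n + 1) * r ^ (i + n) * norm (z - w))"
  proof (rule norm_suminf_le)
    show "summable (\<lambda>i. a (i + n + 1) * r ^ (i + n) * norm (z - w))" using sm by (rule summable_mult2)
    fix i
    define k where "k = i + (n + 1)"
    have "norm (c k * z ^ k - c k * w ^ k) = norm (c k) * norm (z ^ k - w ^ k)"
      by (simp flip: right_diff_distrib add: norm_mult)
    also have "\<dots> \<le> norm (c k) * (real k * r ^ (k - 1) * norm (z - w))"
      by (intro mult_left_mono norm_power_diff_le zw) auto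
    also have "\<dots> = (real k * norm (c k)) * (r ^ (k - 1) * norm (z - w))" by (simp add: mult_ac)
    also have "\<dots> \<le> a k * (r ^ (k - 1) * norm (z - w))"
      using a[of k] r0 by (intro mult_right_mono) (auto simp: c_def k_def)
    finally show "norm (c (i + (n + 1)) * z ^ (i + (n + 1)) - c (i + (n + 1)) * w ^ (i + (n + 1)))
        \<le> a (i + n + 1) * r ^ (i + n) * norm (z - w)" by (simp add: k_def mult.assoc)
  qed
  also have "\<dots> = (\<Sum>i. a (i + n + 1) * r ^ (i + n)) * norm (z - w)"
    using suminf_mult2[OF sm] by simp
  finally show ?thesis unfolding c_def[symmetric] sums_unique[OF D] .
qed

text \<open>For fixed \<open>z1, z2\<close> a unimodular \<open>\<epsilon>\<close> turns the harmonic difference into that of the analytic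
  function \<open>F = h + \<epsilon> g\<close>, and \<open>F' = h' (1 + \<epsilon>' z)\<close> makes \<open>F\<close> close-to-convex.\<close>
lemma class_F_expansion:
  assumes \<alpha>: "0 \<le> \<alpha>" "\<alpha> < 1" and F: "class_F \<alpha> h g"
    and z: "norm z1 \<le> r" "norm z2 \<le> r" "r < 1"
  shows "(1 - r) * (1 + r) powr (- 2 * (1 - \<alpha>)) * norm (z1 - z2)
    \<le> norm ((h z1 - h z2) + exp (\<i> * of_real \<theta>) * cnj (g z1 - g z2))"
proof -
  have r0: "0 \<le> r" using z norm_ge_zero order_trans by blast
  interpret convex_function h
  proof
    show "h holomorphic_on ball 0 1" "\<And>z. z \<in> ball 0 1 \<Longrightarrow> deriv h z \<noteq> 0"
      using F by (auto simp: class_F_def)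
    show "Re (1 + z * deriv (deriv h) z / deriv h z) > 0" if "z \<in> ball 0 1" for z
      using class_F_Re[OF \<alpha>(2) F that] \<alpha>(1) by simp
  qed
  define m where "m = (1 + r) powr (- 2 * (1 - \<alpha>))"
  have m: "m \<le> norm (deriv h z)" if "norm z \<le> r" for z
  proof -
    have "m \<le> (1 + norm z) powr (- 2 * (1 - \<alpha>))"
      unfolding m_def using that \<alpha> add_pos_nonneg[OF zero_less_one norm_ge_zero[of z]]
      by (intro powr_mono2') auto
    also have "\<dots> \<le> norm (deriv h z)" using that z by (intro class_F_distortion[OF \<alpha>(2) F]) auto
    finally show ?thesis .
  qed
  have "m > 0" using r0 by (simp add: m_def)
  then have 1: "m * norm (z1 - z2) \<le> norm (h z1 - h z2)" using m by (rule expansion_le[OF z])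
  define \<Delta> where "\<Delta> = g z1 - g z2"
  \<comment> \<open>For \<open>\<Delta> = 0\<close> any unimodular value would do.\<close>
  define \<epsilon> where "\<epsilon> = (if \<Delta> = 0 then 1 else exp (\<i> * of_real \<theta>) * cnj \<Delta> / \<Delta>)"
  have \<epsilon>: "norm \<epsilon> = 1" "\<epsilon> * \<Delta> = exp (\<i> * of_real \<theta>) * cnj \<Delta>"
    by (auto simp: \<epsilon>_def norm_mult norm_divide)
  obtain t :: real where t: "\<And>z. z \<in> ball 0 1 \<Longrightarrow> deriv g z = exp (\<i> * of_real t) * z * deriv h z"
    using F unfolding class_F_def by blast
  define q where "q z = 1 + \<epsilon> * exp (\<i> * of_real t) * z" for z
  define G where "G z = h z + \<epsilon> * g z" for z
  have "(1 - r) * norm (h z1 - h z2) \<le> norm (G z1 - G z2)"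
  proof (rule close_to_convex_expansion[OF z])
    fix z :: complex assume zr: "norm z \<le> r"
    have "(h has_field_derivative deriv h z) (at z)" using zr z by (intro has_deriv) auto
    moreover have "(g has_field_derivative deriv g z) (at z)"
      using holomorphic_derivI[OF class_F_holo(2)[OF \<alpha>(2) F] open_ball] zr z by auto
    ultimately have "(G has_field_derivative deriv h z + \<epsilon> * deriv g z) (at z)"
      unfolding G_def[abs_def] by (intro DERIV_add DERIV_cmult)
    moreover have "deriv h z + \<epsilon> * deriv g z = deriv h z * q z"
      using t[of z] zr z by (simp add: q_def algebra_simps)
    ultimately show "(G has_field_derivative deriv h z * q z) (at z)" by simp
    have "- Re (\<epsilon> * exp (\<i> * of_real t) * z) \<le> norm (\<epsilon> * exp (\<i> * of_real t) * z)"
      using abs_Re_le_cmod[of "\<epsilon> * exp (\<i> * of_real t) * z"] by linarith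
    also have "\<dots> = norm z" by (simp add: norm_mult \<epsilon>)
    finally show "1 - r \<le> Re (q z)" using zr unfolding q_def plus_complex.sel one_complex.sel by linarith
  qed
  moreover have "G z1 - G z2 = (h z1 - h z2) + exp (\<i> * of_real \<theta>) * cnj (g z1 - g z2)"
    using \<epsilon>(2) by (simp add: G_def \<Delta>_def algebra_simps)
  moreover have "(1 - r) * (m * norm (z1 - z2)) \<le> (1 - r) * norm (h z1 - h z2)"
    using 1 z by (intro mult_left_mono) auto
  ultimately show ?thesis by (simp add: m_def mult.assoc)
qed

lemma s_nm_inj_on:
  assumes \<alpha>: "0 \<le> \<alpha>" "\<alpha> < 1" and F: "class_F \<alpha> h g" and nm: "n \<ge> 2" "m \<ge> 2"
  shows "inj_on (s_nm n m h g \<theta>) (ball 0 (r_nm n m \<alpha>))"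
proof (rule inj_onI, rule ccontr)
  fix z w assume zw: "z \<in> ball 0 (r_nm n m \<alpha>)" "w \<in> ball 0 (r_nm n m \<alpha>)"
    and eq: "s_nm n m h g \<theta> z = s_nm n m h g \<theta> w" and ne: "z \<noteq> w"
  \<comment> \<open>This radius is positive because the points differ, and strictly below the first
    zero, so \<open>psi\<close> is positive there.\<close>
  define r where "r = max (norm z) (norm w)"
  have r: "0 < r" "r < r_nm n m \<alpha>" "norm z \<le> r" "norm w \<le> r"
    using zw ne by (auto simp: r_def max_def)
  have r1: "r < 1" using r r_nm(2)[OF \<alpha> nm] by simp
  define e where "e = exp (\<i> * of_real \<theta>)"
  have ne1: "norm e = 1" by (simp add: e_def)
  let ?u = "h_majorant \<alpha>" and ?v = "g_majorant \<alpha>"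
  define U where "U = (\<Sum>i. ?u (i + n + 1) * r ^ (i + n))"
  define V where "V = (\<Sum>i. ?v (i + m + 1) * r ^ (i + m))"
  define Rh where "Rh x = h x - (\<Sum>k=1..n. taylor_coeff h k * x ^ k)" for x
  define Rg where "Rg x = g x - (\<Sum>k=1..m. taylor_coeff g k * x ^ k)" for x
  have h0: "h 0 = 0" "g 0 = 0" using F by (auto simp: class_F_def)
  have bh: "norm (Rh z - Rh w) \<le> U * norm (z - w)"
    unfolding Rh_def U_def
  proof (rule norm_taylor_remainder_diff_le[OF class_F_holo(1)[OF \<alpha>(2) F] h0(1)])
    show "real k * norm (taylor_coeff h k) \<le> ?u k" if "k > n" for k
      using class_F_coeff_h_le[OF \<alpha>(2) F, of k] that by (intro mult_left_mono) auto
    show "summable (\<lambda>i. ?u (i + n + 1) * r ^ (i + n))"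
      by (rule tail_series_eq(1)[of ?u n r]) (use h_majorant_bounds[OF \<alpha>] nm r r1 in auto)
  qed (use r r1 in auto)
  have bg: "norm (Rg z - Rg w) \<le> V * norm (z - w)"
    unfolding Rg_def V_def
  proof (rule norm_taylor_remainder_diff_le[OF class_F_holo(2)[OF \<alpha>(2) F] h0(2)])
    show "real k * norm (taylor_coeff g k) \<le> ?v k" if "k > m" for k
      using mult_left_mono[OF class_F_coeff_g_le[OF \<alpha>(2) F, of k], of "real k"] that nm by simp
    show "summable (\<lambda>i. ?v (i + m + 1) * r ^ (i + m))"
      by (rule tail_series_eq(1)[of ?v m r, OF g_majorant_bounds[OF \<alpha>]]) (use nm r r1 in auto)
  qed (use r r1 in auto)
  have s_eq: "s_nm n m h g \<theta> x = (h x - Rh x) + e * cnj (g x - Rg x)" for x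
    by (simp add: s_nm_def e_def Rh_def Rg_def)
  \<comment> \<open>A collision of the polynomial forces the full harmonic difference to equal the
    difference of the remainders.\<close>
  have "(h z - h w) + e * cnj (g z - g w) = (Rh z - Rh w) + e * cnj (Rg z - Rg w)"
    using eq unfolding s_eq by (simp add: algebra_simps)
  also have "norm \<dots> \<le> norm (Rh z - Rh w) + norm (e * cnj (Rg z - Rg w))" by (rule norm_triangle_ineq)
  also have "norm (e * cnj (Rg z - Rg w)) = norm (Rg z - Rg w)"
    by (simp only: norm_mult ne1 complex_mod_cnj mult_1)
  also have "norm (Rh z - Rh w) + \<dots> \<le> (U + V) * norm (z - w)"
    using bh bg by (simp add: distrib_right)
  finally have "norm ((h z - h w) + e * cnj (g z - g w)) \<le> (U + V) * norm (z - w)" .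
  moreover have "(1 - r) * (1 + r) powr (- 2 * (1 - \<alpha>)) * norm (z - w)
      \<le> norm ((h z - h w) + e * cnj (g z - g w))"
    unfolding e_def using r r1 by (intro class_F_expansion[OF \<alpha> F])
  moreover have "A_fun r \<alpha> * norm (z - w) \<le> (1 - r) * (1 + r) powr (- 2 * (1 - \<alpha>)) * norm (z - w)"
    using A_fun_le[OF r(1) r1 \<alpha>] by (intro mult_right_mono) auto
  ultimately have "A_fun r \<alpha> * norm (z - w) \<le> (U + V) * norm (z - w)" by linarith
  then have "A_fun r \<alpha> \<le> U + V" using ne by simp
  moreover have "psi n m r \<alpha> > 0" using r_nm(4)[OF \<alpha> nm r(1,2)] .
  ultimately show False unfolding psi_eq U_def V_def by linarith
qed

section \<open>The case \<open>\<alpha> = 1/2\<close>\<close>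

text \<open>The product is then \<open>(k - 1)!\<close>; as a consequence both tails of
  \<open>psi\<close> become geometric series.\<close>

lemma A_coef_half: "k \<ge> 1 \<Longrightarrow> real k * A_coef k (1/2) = 1"
proof (induction k rule: dec_induct)
  case (step k)
  then show ?case using A_coef_Suc[of k "1/2"] by simp
qed simp

text \<open>Concavity puts \<open>ln (1 + r)\<close> above its chord \<open>r * ln 2\<close>. The
  resulting linear bound keeps \<open>L / r\<close> away from 0 uniformly in
  \<open>r\<close>.\<close>

lemma L_fun_half_ge:
  assumes r: "0 \<le> r" "r \<le> 1"
  shows "r * (2 * ln 2 - 1) \<le> L_fun r (1/2)"
proof -
  have "((\<lambda>x. (1 - x) * (1 + x) powr (- 2 * (1 - 1/2))) has_integral
      ((2 * ln (1 + r) - r) - (2 * ln (1 + 0) - 0))) {0..r}"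
  proof (rule fundamental_theorem_of_calculus)
    fix x assume x: "x \<in> {0..r}"
    have "((\<lambda>x. 2 * ln (1 + x) - x) has_real_derivative (1 - x) * (1 + x) powr (- 2 * (1 - 1/2))) (at x)"
      using x by (auto intro!: derivative_eq_intros simp: powr_minus field_simps)
    then show "((\<lambda>x. 2 * ln (1 + x) - x) has_vector_derivative (1 - x) * (1 + x) powr (- 2 * (1 - 1/2))) (at x within {0..r})"
      unfolding has_real_derivative_iff_has_vector_derivative by (rule has_vector_derivative_at_within)
  qed (use r in simp)
  then have L: "L_fun r (1/2) = 2 * ln (1 + r) - r" unfolding L_fun_def by (simp add: integral_unique)
  have "ln ((1 + 1) powr r) \<le> ln (1 + r * 1)"
    using r one_plus_powr_le[of 1 r] by (subst ln_le_cancel_iff) auto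
  then have "r * ln 2 \<le> ln (1 + r)" by simp
  then show ?thesis unfolding L by (simp add: algebra_simps)
qed

text \<open>Three decimals give \<open>2 * ln 2 - 1 \<ge> 0.386\<close>, the constant in the
  estimates below.\<close>

lemma ln_2_ge: "ln 2 \<ge> (0.693 :: real)"
proof -
  have "ln 2 \<in> {307/443<..<4615/6658 :: real}"
    using ln_approx_bounds[of 2 3] by (simp add: eval_nat_numeral)
  then show ?thesis by simp
qed

text \<open>The left side of the condition increases with \<open>b\<close> and the right side
  decreases, so one inequality at \<open>b\<close> excludes zeros on all of
  \<open>(0, b]\<close>.\<close>

lemma psi_half_pos:
  assumes nm: "n \<ge> l" "m \<ge> l" "l \<ge> 2" and r: "0 < r" "r \<le> b" "b < 1"
    and b: "2 * b ^ l < 0.386\<^sup>2 * (1 - b)\<^sup>2"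
  shows "psi n m r (1/2) > 0"
proof -
  have r1: "r < 1" using r by simp
  have geo: "(\<Sum>i. r ^ (i + k)) = r ^ k / (1 - r)" for k
    using suminf_mult[OF summable_geometric[of r], of "r ^ k"] suminf_geometric[of r] r r1
    by (simp add: power_add mult.commute)
  have v: "real k * (real k - 1) / (real k - 2 * (1/2)) * A_coef k (1/2) = 1" if "k \<ge> 2" for k
  proof -
    have "real k * (real k - 1) / (real k - 2 * (1/2)) = real k" using that by (simp add: field_simps)
    then show ?thesis using A_coef_half[of k] that by simp
  qed
  have "(\<Sum>i. real (i + n + 1) * A_coef (i + n + 1) (1/2) * r ^ (i + n)) = (\<Sum>i. r ^ (i + n))"
    by (simp only: A_coef_half[OF le_add2] mult_1)
  moreover have "(\<Sum>i. real (i + m + 1) * (real (i + m + 1) - 1) / (real (i + m + 1) - 2 * (1/2)) * A_coef (i + m + 1) (1/2) * r ^ (i + m))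
      = (\<Sum>i. r ^ (i + m))"
  proof (rule suminf_cong)
    fix i
    have "i + m + 1 \<ge> 2" using nm by simp
    from v[OF this] show "real (i + m + 1) * (real (i + m + 1) - 1) / (real (i + m + 1) - 2 * (1/2)) * A_coef (i + m + 1) (1/2) * r ^ (i + m)
        = r ^ (i + m)" by (simp only: mult_1)
  qed
  ultimately have psi: "psi n m r (1/2) = A_fun r (1/2) - r ^ n / (1 - r) - r ^ m / (1 - r)"
    unfolding psi_eq by (simp only: geo)
  have "r ^ n \<le> b ^ l" "r ^ m \<le> b ^ l"
    using nm r r1 by (meson less_imp_le order_trans power_decreasing power_mono)+
  then have "r ^ n + r ^ m \<le> 2 * b ^ l" by simp
  also have "\<dots> < 0.386\<^sup>2 * (1 - b)\<^sup>2" by (rule b)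
  also have "\<dots> \<le> 0.386\<^sup>2 * (1 - r)\<^sup>2" using r by (intro mult_left_mono power_mono) auto
  also have "\<dots> \<le> (1 - r) * A_fun r (1/2)"
  proof -
    have "r * 0.386 \<le> r * (2 * ln 2 - 1)" using ln_2_ge r by (intro mult_left_mono) auto
    also have "\<dots> \<le> L_fun r (1/2)" using r r1 by (intro L_fun_half_ge) auto
    finally have "(r * 0.386)\<^sup>2 \<le> (L_fun r (1/2))\<^sup>2" using r by (intro power_mono) auto
    then have "0.386\<^sup>2 \<le> (L_fun r (1/2))\<^sup>2 / r\<^sup>2" using r by (simp add: power_mult_distrib field_simps)
    \<comment> \<open>This weakens \<open>1 - r^2\<close> to \<open>1 - r\<close>, so that the final
      condition involves only \<open>(1 - r)^2\<close>.\<close>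
    moreover have "r\<^sup>2 \<le> r" using r r1 by (simp add: power2_eq_square mult_left_le)
    ultimately have "(1 - r) * 0.386\<^sup>2 \<le> (1 - r\<^sup>2) * ((L_fun r (1/2))\<^sup>2 / r\<^sup>2)"
      using r1 by (intro mult_mono) auto
    then have "(1 - r) * 0.386\<^sup>2 \<le> A_fun r (1/2)" by (simp add: A_fun_def)
    then have "(1 - r) * ((1 - r) * 0.386\<^sup>2) \<le> (1 - r) * A_fun r (1/2)" using r1 by (intro mult_left_mono) auto
    then show ?thesis by (simp add: power2_eq_square mult_ac)
  qed
  finally have "(r ^ n + r ^ m) / (1 - r) < A_fun r (1/2)" using r1 by (simp add: field_simps)
  then show ?thesis unfolding psi by (simp add: add_divide_distrib)
qed

text \<open>For large \<open>l\<close> the choice \<open>b = 1 - 2 ln l / l\<close> works because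
  \<open>b ^ l \<le> 1 / l^2\<close>, which leaves \<open>2 < 0.386^2 * 4 * (ln l)^2\<close>. The
  bound \<open>ln 8 \<ge> 2.079\<close> secures this from \<open>l = 8\<close> on; smaller
  \<open>l\<close> are settled by explicit numbers.\<close>

lemma radius_bound:
  assumes "l \<ge> 3"
  obtains b where "1 - 2 * ln (real l) / real l \<le> b" "b < 1" "2 * b ^ l < 0.386\<^sup>2 * (1 - b)\<^sup>2"
proof -
  have ln4: "ln 4 \<ge> (1.386::real)"
    using ln_2_ge ln_realpow[of 2 2] by simp
  have ln8: "ln 8 \<ge> (2.079::real)"
    using ln_2_ge ln_realpow[of 2 3] by simp
  \<comment> \<open>From \<open>8 \<le> 9\<close>, that is,
    \<open>3 * ln 2 \<le> 2 * ln 3\<close>.\<close>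
  have ln3: "ln 3 \<ge> (1.039::real)"
  proof -
    have "ln 8 \<le> ln (9::real)" by simp
    also have "\<dots> = 2 * ln 3" using ln_realpow[of 3 2] by simp
    finally show ?thesis using ln8 by simp
  qed
  have ln6: "ln 6 \<ge> (1.732::real)" using ln_mult[of 2 "3::real"] ln_2_ge ln3 by simp
  have ln5: "ln 5 \<ge> (1.386::real)" using ln4 ln_le_cancel_iff[of 4 "5::real"] by linarith
  have ln7: "ln 7 \<ge> (1.732::real)" using ln6 ln_le_cancel_iff[of 6 "7::real"] by linarith
  \<comment> \<open>In the small cases the witness is \<open>1 - 2 * c / l\<close> rounded up, with
    \<open>c\<close> the lower bound for \<open>ln l\<close> obtained above.\<close>
  consider "l = 3" | "l = 4" | "l = 5" | "l = 6" | "l = 7" | "l \<ge> 8" using assms by linarith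
  then show thesis
  proof cases
    case 1 then show thesis using ln3 by (intro that[of "0.308"]) (auto simp: power2_eq_square power_numeral_reduce)
  next
    case 2 then show thesis using ln4 by (intro that[of "0.308"]) (auto simp: power2_eq_square power_numeral_reduce)
  next
    case 3 then show thesis using ln5 by (intro that[of "0.446"]) (auto simp: power2_eq_square power_numeral_reduce)
  next
    case 4 then show thesis using ln6 by (intro that[of "0.43"]) (auto simp: power2_eq_square power_numeral_reduce)
  next
    case 5 then show thesis using ln7 by (intro that[of "0.51"]) (auto simp: power2_eq_square power_numeral_reduce)
  next
    case 6
    define x where "x = 2 * ln (real l) / real l"
    have "ln 8 \<le> ln (real l)" using 6 by simp
    then have lnl: "ln (real l) \<ge> 2.079" using ln8 by (rule order_trans[rotated])
    have x0: "x > 0" using lnl 6 by (simp add: x_def)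
    \<comment> \<open>Needed for a nonnegative base when powers are compared; it comes from the
      tangent of the logarithm at 2.\<close>
    have x1: "x \<le> 1"
    proof -
      have "ln (real l / 2) \<le> real l / 2 - 1" using 6 by (intro ln_le_minus_one) simp
      then have "ln (real l) \<le> real l / 2 - 1 + ln 2" using 6 by (simp add: ln_div)
      also have "ln 2 \<le> (1::real)" using ln_le_minus_one[of "2::real"] by simp
      finally show ?thesis using 6 by (simp add: x_def field_simps)
    qed
    have "(1 - x) ^ l \<le> exp (- x) ^ l" using x1 exp_ge_add_one_self[of "- x"] by (intro power_mono) auto
    also have "\<dots> = exp (- (2 * ln (real l)))" using 6 by (simp add: x_def flip: exp_of_nat_mult)
    also have "\<dots> = 1 / (real l)\<^sup>2" using 6 by (simp add: exp_minus exp_double inverse_eq_divide)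
    finally have "2 * (1 - x) ^ l \<le> 2 / (real l)\<^sup>2" by simp
    also have "\<dots> < 0.386\<^sup>2 * (4 * 2.079\<^sup>2) / (real l)\<^sup>2"
      using 6 by (intro divide_strict_right_mono) (auto simp: power2_eq_square)
    also have "\<dots> \<le> 0.386\<^sup>2 * (4 * (ln (real l))\<^sup>2) / (real l)\<^sup>2"
      using lnl by (intro divide_right_mono mult_left_mono power_mono) auto
    also have "\<dots> = 0.386\<^sup>2 * x\<^sup>2" by (simp add: x_def power_divide power_mult_distrib)
    finally show thesis using x0 by (intro that[of "1 - x"]) (auto simp: x_def)
  qed
qed

theorem theorem3:
  fixes \<alpha> :: real and h g :: "complex \<Rightarrow> complex" and n m :: nat
  assumes "0 \<le> \<alpha>" and "\<alpha> < 1"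
    and "class_F \<alpha> h g"
    and "n \<ge> 2" and "m \<ge> 2"
  shows "(\<forall>\<theta>::real. inj_on (s_nm n m h g \<theta>) (ball 0 (r_nm n m \<alpha>)))
       \<and> (\<alpha> = 1/2 \<and> min n m \<ge> 3 \<longrightarrow>
            r_nm n m \<alpha> \<ge> 1 - 2 * ln (real (min n m)) / real (min n m))"
proof (intro conjI allI impI)
  show "inj_on (s_nm n m h g \<theta>) (ball 0 (r_nm n m \<alpha>))" for \<theta>
    using s_nm_inj_on[OF assms] .
  assume *: "\<alpha> = 1/2 \<and> min n m \<ge> 3"
  obtain b where b: "1 - 2 * ln (real (min n m)) / real (min n m) \<le> b" "b < 1"
      "2 * b ^ min n m < 0.386\<^sup>2 * (1 - b)\<^sup>2"
    using radius_bound * by blast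
  \<comment> \<open>Otherwise the zero \<open>r_nm\<close> would lie in \<open>(0, b]\<close>, where
    \<open>psi\<close> is positive.\<close>
  have "b < r_nm n m \<alpha>"
  proof (rule ccontr)
    assume "\<not> b < r_nm n m \<alpha>"
    then have "r_nm n m \<alpha> \<le> b" by simp
    moreover have "min n m \<ge> 2" using * by simp
    ultimately have "psi n m (r_nm n m \<alpha>) (1/2) > 0"
      using psi_half_pos[OF min.cobounded1 min.cobounded2] r_nm(1)[OF assms(1,2,4,5)] b(2,3) by blast
    then show False using r_nm(3)[OF assms(1,2,4,5)] * by simp
  qed
  then show "r_nm n m \<alpha> \<ge> 1 - 2 * ln (real (min n m)) / real (min n m)" using b(1) by simp
qed

end
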